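(* Let $m,n\ge 1$, let $f_1,\dots,f_m:\mathbb{R}^n\to\mathbb{R}$, and let $\mathcal{G}(\mathcal{V},\mathcal{E})$ be an undirected graph with $\mathcal{V}=\{1,\dots,m\}$. Suppose: (1) each $f_i$ is differentiable and there is a constant $L_{f_i}$ with $\|\nabla f_i(\mathbf{x})-\nabla f_i(\mathbf{y})\|\le L_{f_i}\|\mathbf{x}-\mathbf{y}\|$ for all $\mathbf{x},\mathbf{y}\in\mathbb{R}^n$; (2) each $f_i$ is coercive (its sublevel sets are compact) and proper (not everywhere infinite); (3) $\mathcal{G}$ is connected; (4) $\mathbf{W},\mathbf{V}\in\mathbb{R}^{m\times m}$ satisfy: $\mathbf{W}_{ij}=0$ whenever $i\ne j$ and $(i,j)\notin\mathcal{E}$; $\mathbf{W}=\mathbf{W}^\top$; $-\mathbf{I}_m\prec\mathbf{W}\preceq\mathbf{I}_m$ and $\mathrm{null}\{\mathbf{I}_m-\mathbf{W}\}=\mathrm{span}\{\mathbf{1}_m\}$; and $\mathbf{V}=\theta\mathbf{I}_m+(1-\theta)\mathbf{W}\succ 0$ for some $\theta\in(0,\tfrac12]$. Let $L_F=\max_i L_{f_i}$ and let the step-size $\alpha$ be fixed with $$0<\alpha<\frac{1-(\lambda_1(\mathbf{P}))^2}{6(L_F)^4+6(L_F)^3+48L_F+1}.$$ Then the sequence $\{\hat{\mathbf{x}}^k\}$ generated by the EXTRA iteration with step-size $\alpha$ satisfies $$\lim_{k\to\infty}\Big\|\big(\mathbf{I}_{mn}-\tfrac1m(\mathbf{1}_m\mathbf{1}_m^\top)\otimes\mathbf{I}_n\big)\hat{\mathbf{x}}^k\Big\|=0,\qquad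 \lim_{k\to\infty}\Big\|\tfrac1m(\mathbf{1}_m\mathbf{1}_m^\top)\otimes\mathbf{I}_n\cdot\nabla F(\hat{\mathbf{x}}^k)\Big\|=0.$$
   Context: Notation: $\mathbf{I}_n$ is the identity matrix, $\mathbf{1}_m$ the all-ones vector in $\mathbb{R}^m$, $\otimes$ the Kronecker product. For $\hat{\mathbf{x}}=[\hat{\mathbf{x}}_1^\top,\dots,\hat{\mathbf{x}}_m^\top]^\top\in(\mathbb{R}^n)^m$ put $F(\hat{\mathbf{x}})=\sum_{i=1}^m f_i(\hat{\mathbf{x}}_i)$, so that $\nabla F(\hat{\mathbf{x}})=[\nabla f_1(\hat{\mathbf{x}}_1)^\top,\dots,\nabla f_m(\hat{\mathbf{x}}_m)^\top]^\top$. EXTRA: given an initial point $\hat{\mathbf{x}}^0\in(\mathbb{R}^n)^m$ and step-size $\alpha>0$, with $\hat{\mathbf{W}}=\mathbf{W}\otimes\mathbf{I}_n$ and $\hat{\mathbf{V}}=\mathbf{V}\otimes\mathbf{I}_n$, $$\hat{\mathbf{x}}^1=\hat{\mathbf{W}}\hat{\mathbf{x}}^0-\alpha\nabla F(\hat{\mathbf{x}}^0),\qquad \hat{\mathbf{x}}^{k+2}=\hat{\mathbf{x}}^{k+1}+\hat{\mathbf{W}}\hat{\mathbf{x}}^{k+1}-\hat{\mathbf{V}}\hat{\mathbf{x}}^k-\alpha[\nabla F(\hat{\mathbf{x}}^{k+1})-\nabla F(\hat{\mathbf{x}}^k)],\quad k\ge 0.$$ The matrix $\mathbf{P}\in\mathbb{R}^{2m\times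 2m}$ is $$\mathbf{P}=\begin{bmatrix}\mathbf{W}-\frac1m\mathbf{1}_m\mathbf{1}_m^\top & \mathbf{I}_m\\ \mathbf{W}-\mathbf{V} & \mathbf{I}_m-\frac1m\mathbf{1}_m\mathbf{1}_m^\top\end{bmatrix},$$ and for a square matrix $\mathbf{C}$, $\lambda_1(\mathbf{C})\ge 0$ denotes the largest magnitude of an eigenvalue of $\mathbf{C}$ (the spectral radius). *)

theory Defs
  imports "HOL-Analysis.Analysis"
begin

text \<open>
  Conventions. The index sets \<open>{1..m}\<close> and \<open>{1..n}\<close> are finite types \<open>'m\<close> and \<open>'n\<close>, so that
  \<open>m = CARD('m) \<ge> 1\<close> and \<open>n = CARD('n) \<ge> 1\<close>. A stacked vector of \<open>(R^n)^m\<close>, viewed as an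
  \<open>mn\<close>-vector, has type \<open>real ^ ('m \<times> 'n)\<close>; its coordinate \<open>(i, j)\<close> is coordinate \<open>j\<close> of block \<open>i\<close>.
  Recall that \<open>mat 1\<close> is the identity matrix and \<open>vec 1\<close> the all-ones vector.
\<close>

definition kronecker :: "real ^ 'b ^ 'a \<Rightarrow> real ^ 'd ^ 'c \<Rightarrow> real ^ ('b \<times> 'd) ^ ('a \<times> 'c)"
    (infixl "\<otimes>\<^sub>K" 75) where
  "A \<otimes>\<^sub>K B = (\<chi> p q. A $ fst p $ fst q * B $ snd p $ snd q)"

definition block_matrix ::
    "real ^ 'c ^ 'a \<Rightarrow> real ^ 'd ^ 'a \<Rightarrow> real ^ 'c ^ 'b \<Rightarrow> real ^ 'd ^ 'b \<Rightarrow> real ^ ('c + 'd) ^ ('a + 'b)" where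
  "block_matrix A B C D = (\<chi> p q.
     case p of
       Inl i \<Rightarrow> (case q of Inl j \<Rightarrow> A $ i $ j | Inr j \<Rightarrow> B $ i $ j)
     | Inr i \<Rightarrow> (case q of Inl j \<Rightarrow> C $ i $ j | Inr j \<Rightarrow> D $ i $ j))"

text \<open>The averaging matrix \<open>(1/m) 1 1^T\<close>; the inner dimension of the product is the one-element type.\<close>

definition avg_matrix :: "real ^ 'm ^ 'm" where
  "avg_matrix = (1 / real CARD('m)) *\<^sub>R
     ((columnvector (vec 1) :: real ^ 1 ^ 'm) ** (rowvector (vec 1) :: real ^ 'm ^ 1))"

text \<open>Eigenvalues of a real matrix are taken over the complex numbers.\<close>

definition complex_eigenvalues :: "real ^ 'a ^ 'a \<Rightarrow> complex set" where
  "complex_eigenvalues C =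
     {z. \<exists>v :: complex ^ 'a. v \<noteq> 0 \<and> (\<chi> i j. complex_of_real (C $ i $ j)) *v v = z *s v}"

definition spectral_radius :: "real ^ 'a ^ 'a \<Rightarrow> real" where
  "spectral_radius C = Max (cmod ` complex_eigenvalues C)"

definition pos_semidef :: "real ^ 'a ^ 'a \<Rightarrow> bool" where
  "pos_semidef A \<longleftrightarrow> transpose A = A \<and> (\<forall>v. v \<bullet> (A *v v) \<ge> 0)"

definition pos_def :: "real ^ 'a ^ 'a \<Rightarrow> bool" where
  "pos_def A \<longleftrightarrow> transpose A = A \<and> (\<forall>v. v \<noteq> 0 \<longrightarrow> v \<bullet> (A *v v) > 0)"

definition connected_graph :: "('m \<times> 'm) set \<Rightarrow> bool" where
  "connected_graph E \<longleftrightarrow> (\<forall>i j. (i, j) \<in> E\<^sup>*)"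

text \<open>
  The functions below are real-valued and hence automatically proper (not everywhere infinite), so
  properness has no separate definition.
\<close>

definition coercive :: "(real ^ 'n \<Rightarrow> real) \<Rightarrow> bool" where
  "coercive f \<longleftrightarrow> (\<forall>c. compact {x. f x \<le> c})"

text \<open>Meaningful only at points where \<open>f\<close> is differentiable.\<close>

definition gradient :: "('a :: real_inner \<Rightarrow> real) \<Rightarrow> 'a \<Rightarrow> 'a" where
  "gradient f x = (THE g. GDERIV f x :> g)"

definition block :: "real ^ ('m::finite \<times> 'n::finite) \<Rightarrow> 'm \<Rightarrow> real ^ 'n" where
  "block x i = (\<chi> j. x $ (i, j))"

definition stacked_sum :: "('m::finite \<Rightarrow> real ^ 'n::finite \<Rightarrow> real) \<Rightarrow> real ^ ('m \<times> 'n) \<Rightarrow> real" where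
  "stacked_sum f x = (\<Sum>i\<in>UNIV. f i (block x i))"

fun extra :: "real ^ 'm ^ 'm \<Rightarrow> real ^ 'm ^ 'm \<Rightarrow> ('m \<Rightarrow> real ^ 'n \<Rightarrow> real) \<Rightarrow> real \<Rightarrow>
    real ^ ('m \<times> 'n) \<Rightarrow> nat \<Rightarrow> real ^ ('m \<times> 'n)" where
  "extra W V f \<alpha> x0 0 = x0"
| "extra W V f \<alpha> x0 (Suc 0) =
     (W \<otimes>\<^sub>K (mat 1 :: real ^ 'n ^ 'n)) *v x0 - \<alpha> *\<^sub>R gradient (stacked_sum f) x0"
| "extra W V f \<alpha> x0 (Suc (Suc k)) =
     extra W V f \<alpha> x0 (Suc k)
     + (W \<otimes>\<^sub>K (mat 1 :: real ^ 'n ^ 'n)) *v extra W V f \<alpha> x0 (Suc k)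
     - (V \<otimes>\<^sub>K (mat 1 :: real ^ 'n ^ 'n)) *v extra W V f \<alpha> x0 k
     - \<alpha> *\<^sub>R (gradient (stacked_sum f) (extra W V f \<alpha> x0 (Suc k))
             - gradient (stacked_sum f) (extra W V f \<alpha> x0 k))"

definition P_matrix :: "real ^ 'm ^ 'm \<Rightarrow> real ^ 'm ^ 'm \<Rightarrow> real ^ ('m + 'm) ^ ('m + 'm)" where
  "P_matrix W V = block_matrix (W - avg_matrix) (mat 1) (W - V) (mat 1 - avg_matrix)"

end

theory Submission
  imports Defs
begin

text \<open>
  Expand everything in an orthonormal eigenbasis of \<open>W \<otimes> I\<close>. On the consensus modes (eigenvalue \<open>1\<close>)
  EXTRA is plain gradient descent with the averaged gradient. On a mode with eigenvalue \<open>w \<noteq> 1\<close> it is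
  a scalar recursion with characteristic polynomial \<open>z\<^sup>2 - (1 + w) z + v\<close>, \<open>v = \<theta> + (1 - \<theta>) w\<close>,
  driven by \<open>\<alpha>\<close> times the increment of the gradient; both roots are eigenvalues of \<open>P\<close>, hence bounded
  by \<open>\<rho> = \<lambda>\<^sub>1(P) < 1\<close>. The \<open>\<ell>\<^sub>2\<close>-gain from the forcing is \<open>(1 - \<rho>)\<^bsup>-2\<^esup>\<close> to the mode and
  \<open>O((1 - \<rho>)\<^bsup>-1\<^esup>)\<close> to its increments. The step-size bound gives \<open>48 \<alpha> L < 1 - \<rho>\<^sup>2 \<le> 2 (1 - \<rho>)\<close>,
  which makes the loop through the Lipschitz gradient a contraction, so the total disagreement is
  a small multiple of the summed squared steps of the average. Descent of \<open>F\<close> along the average,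
  together with \<open>F\<close> being bounded below, makes both sums finite.
\<close>

section \<open>Scalar recursions\<close>

text \<open>Here \<open>e\<close> is a stored energy, \<open>p\<close> the dissipation and
  \<open>d\<close> the supply: the inequality telescopes, and the leftover \<open>e K\<close> is
  nonnegative.\<close>

lemma dissipation_sum_le:
  fixes e p d :: "nat \<Rightarrow> real"
  assumes "\<And>k. e (Suc k) + p k \<le> e k + d k" and "\<And>k. 0 \<le> e k"
  shows "(\<Sum>k<K. p k) \<le> e 0 + (\<Sum>k<K. d k)"
proof -
  have "(\<Sum>k<K. p k) + e K \<le> e 0 + (\<Sum>k<K. d k)"
  proof (induction K)
    case (Suc K)
    then show ?case using assms(1)[of K] by simp
  qed simp
  with assms(2)[of K] show ?thesis by linarith
qed

text \<open>Convexity of the square gives the gain: with \<open>q = b k / (1 - \<rho>)\<close> the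
  right-hand side of the recursion is the convex combination of \<open>a k\<close> and
  \<open>q\<close> with weights \<open>\<rho>\<close> and \<open>1 - \<rho>\<close>, so the square
  of \<open>a\<close> serves as the energy in \<open>dissipation_sum_le\<close>.\<close>

lemma first_order_filter_sum_le:
  fixes a b :: "nat \<Rightarrow> real"
  assumes step: "\<And>k. a (Suc k) \<le> \<rho> * a k + b k"
    and a: "\<And>k. 0 \<le> a k" and \<rho>: "0 \<le> \<rho>" "\<rho> < 1"
  shows "(\<Sum>k<K. (a k)\<^sup>2) \<le> (a 0)\<^sup>2 / (1 - \<rho>) + (\<Sum>k<K. (b k)\<^sup>2) / (1 - \<rho>)\<^sup>2"
proof -
  let ?s = "1 - \<rho>"
  have s: "?s > 0" using \<rho> by simp
  have "(a (Suc k))\<^sup>2 + ?s * (a k)\<^sup>2 \<le> (a k)\<^sup>2 + (b k)\<^sup>2 / ?s" for k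
  proof -
    define q where "q = b k / ?s"
    have "(a (Suc k))\<^sup>2 \<le> (\<rho> * a k + b k)\<^sup>2"
      using step a by (simp add: power_mono)
    also have "\<rho> * a k + b k = \<rho> * a k + ?s * q"
      using s by (simp add: q_def)
    also have "(\<rho> * a k + ?s * q)\<^sup>2 = \<rho> * (a k)\<^sup>2 + ?s * q\<^sup>2 - \<rho> * ?s * (a k - q)\<^sup>2"
      by (simp add: algebra_simps power2_eq_square)
    also have "\<dots> \<le> \<rho> * (a k)\<^sup>2 + ?s * q\<^sup>2"
      using s \<rho> by simp
    also have "?s * q\<^sup>2 = (b k)\<^sup>2 / ?s"
      using s by (simp add: q_def power2_eq_square)
    finally show ?thesis by (simp add: algebra_simps)
  qed
  then have "(\<Sum>k<K. ?s * (a k)\<^sup>2) \<le> (a 0)\<^sup>2 + (\<Sum>k<K. (b k)\<^sup>2 / ?s)"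
    by (intro dissipation_sum_le) auto
  then have "?s * (\<Sum>k<K. (a k)\<^sup>2) \<le> (a 0)\<^sup>2 + (\<Sum>k<K. (b k)\<^sup>2) / ?s"
    by (simp add: sum_distrib_left sum_divide_distrib)
  then have "(\<Sum>k<K. (a k)\<^sup>2) \<le> ((a 0)\<^sup>2 + (\<Sum>k<K. (b k)\<^sup>2) / ?s) / ?s"
    using s by (simp add: pos_le_divide_eq mult.commute)
  then show ?thesis
    by (simp add: add_divide_distrib power2_eq_square)
qed

text \<open>The recursion factors into two first-order filters, each with \<open>\<ell>\<^sub>2\<close>-gain \<open>1 / (1 - \<rho>)\<close>.\<close>

lemma second_order_recursion_l2_gain:
  fixes c d :: "nat \<Rightarrow> real" and r1 r2 :: complex
  assumes rec: "\<And>k. c (Suc (Suc k)) = (1 + w) * c (Suc k) - v * c k - d k"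
    and sum: "r1 + r2 = of_real (1 + w)" and prod: "r1 * r2 = of_real v"
    and le: "cmod r1 \<le> \<rho>" "cmod r2 \<le> \<rho>" and \<rho>: "\<rho> < 1"
  shows "\<exists>C. \<forall>K. (\<Sum>k<K. (c k)\<^sup>2) \<le> C + (\<Sum>k<K. (d k)\<^sup>2) / (1 - \<rho>) ^ 4"
proof -
  have \<rho>0: "0 \<le> \<rho>" using le(1) norm_ge_zero order_trans by blast
  \<comment> \<open>Applying the factor (shift minus \<open>r1\<close>) to \<open>c\<close> leaves a
    first-order filter with pole \<open>r2\<close> driven by \<open>d\<close>. The roots may be
    complex, hence the complex values.\<close>
  define y where "y k = of_real (c (Suc k)) - r1 * of_real (c k)" for k
  have y: "y (Suc k) = r2 * y k - of_real (d k)" for k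
  proof -
    have w: "of_real w = r1 + r2 - 1" using sum by (simp add: algebra_simps)
    show ?thesis unfolding y_def rec using prod[symmetric]
      by (simp add: w algebra_simps)
  qed
  have "cmod (y (Suc k)) \<le> \<rho> * cmod (y k) + \<bar>d k\<bar>" for k
    unfolding y using norm_triangle_ineq4[of "r2 * y k" "of_real (d k)"]
      mult_right_mono[OF le(2) norm_ge_zero[of "y k"]] by (simp add: norm_mult)
  from first_order_filter_sum_le[of "\<lambda>k. cmod (y k)" \<rho> "\<lambda>k. \<bar>d k\<bar>", OF this _ \<rho>0 \<rho>]
  have Y: "(\<Sum>k<K. (cmod (y k))\<^sup>2) \<le> (cmod (y 0))\<^sup>2 / (1 - \<rho>) + (\<Sum>k<K. (d k)\<^sup>2) / (1 - \<rho>)\<^sup>2" for K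
    by simp
  have "\<bar>c (Suc k)\<bar> \<le> \<rho> * \<bar>c k\<bar> + cmod (y k)" for k
  proof -
    have "complex_of_real (c (Suc k)) = r1 * of_real (c k) + y k" by (simp add: y_def)
    then have "\<bar>c (Suc k)\<bar> \<le> cmod (r1 * of_real (c k)) + cmod (y k)"
      by (metis norm_of_real norm_triangle_ineq)
    then show ?thesis using mult_right_mono[OF le(1) abs_ge_zero[of "c k"]] by (simp add: norm_mult)
  qed
  from first_order_filter_sum_le[of "\<lambda>k. \<bar>c k\<bar>" \<rho> "\<lambda>k. cmod (y k)", OF this _ \<rho>0 \<rho>]
  have C: "(\<Sum>k<K. (c k)\<^sup>2) \<le> (c 0)\<^sup>2 / (1 - \<rho>) + (\<Sum>k<K. (cmod (y k))\<^sup>2) / (1 - \<rho>)\<^sup>2" for K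
    by simp
  have "(\<Sum>k<K. (c k)\<^sup>2) \<le> ((c 0)\<^sup>2 / (1 - \<rho>) + (cmod (y 0))\<^sup>2 / (1 - \<rho>) / (1 - \<rho>)\<^sup>2)
      + (\<Sum>k<K. (d k)\<^sup>2) / (1 - \<rho>) ^ 4" for K
  proof -
    have "(\<Sum>k<K. (cmod (y k))\<^sup>2) / (1 - \<rho>)\<^sup>2
        \<le> ((cmod (y 0))\<^sup>2 / (1 - \<rho>) + (\<Sum>k<K. (d k)\<^sup>2) / (1 - \<rho>)\<^sup>2) / (1 - \<rho>)\<^sup>2"
      using Y by (rule divide_right_mono) simp
    also have "\<dots> = (cmod (y 0))\<^sup>2 / (1 - \<rho>) / (1 - \<rho>)\<^sup>2 + (\<Sum>k<K. (d k)\<^sup>2) / (1 - \<rho>) ^ 4"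
      by (simp add: add_divide_distrib power4_eq_xxxx power2_eq_square)
    finally show ?thesis using C[of K] by linarith
  qed
  then show ?thesis by blast
qed

text \<open>
  The energy \<open>(1 - \<mu>) p\<^sub>k\<^sup>2 + \<mu> c\<^sub>k\<^sub>+\<^sub>1\<^sup>2\<close> of the increments \<open>p\<^sub>k = c\<^sub>k\<^sub>+\<^sub>1 - c\<^sub>k\<close>, where \<open>\<mu> = v - w\<close>,
  dissipates \<open>(1 - v\<^sup>2 - \<mu>) p\<^sub>k\<^sup>2 + \<mu>\<^sup>2 c\<^sub>k\<^sub>+\<^sub>1\<^sup>2\<close>. The first coefficient is bounded below by
  \<open>(1 - v) / 2\<close> unless \<open>v\<close> is small and \<open>\<theta>\<close> is large, and then \<open>\<mu>\<close> is bounded below.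
\<close>

lemma second_order_recursion_increment_l2_gain:
  fixes c d :: "nat \<Rightarrow> real"
  assumes rec: "\<And>k. c (Suc (Suc k)) = (1 + w) * c (Suc k) - v * c k - d k"
    and \<theta>: "0 < \<theta>" "\<theta> \<le> 1 / 2" and v: "v = \<theta> + (1 - \<theta>) * w" "0 < v" "v < 1"
  shows "\<exists>C. \<forall>K. (\<Sum>k<K. (c (Suc k) - c k)\<^sup>2) \<le> C + 192 / (1 - v)\<^sup>2 * (\<Sum>k<K. (d k)\<^sup>2)"
proof -
  define \<mu> where "\<mu> = v - w"
  define p where "p k = c (Suc k) - c k" for k
  define e where "e k = (1 - \<mu>) * (p k)\<^sup>2 + \<mu> * (c (Suc k))\<^sup>2" for k
  have \<mu>\<theta>: "(1 - \<theta>) * \<mu> = \<theta> * (1 - v)"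
    unfolding \<mu>_def using v(1) by (simp add: algebra_simps)
  have \<mu>0: "0 < \<mu>"
  proof -
    have "0 < (1 - \<theta>) * \<mu>" unfolding \<mu>\<theta> using \<theta> v by simp
    then show ?thesis using \<theta> by (simp add: zero_less_mult_iff)
  qed
  \<comment> \<open>The bound \<open>\<theta> \<le> 1 / 2\<close> means
    \<open>\<theta> \<le> 1 - \<theta>\<close> and yields \<open>\<mu> \<le> 1 - v\<close>. The
    weight \<open>1 - \<mu>\<close> is then at least \<open>v\<close>, which makes the energy
    nonnegative.\<close>
  have "(1 - \<theta>) * \<mu> \<le> (1 - \<theta>) * (1 - v)"
    unfolding \<mu>\<theta> using \<theta> v by (intro mult_right_mono) auto
  then have \<mu>1: "\<mu> \<le> 1 - v" using \<theta> by simp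
  have e0: "0 \<le> e k" for k unfolding e_def using \<mu>0 \<mu>1 v by simp
  have p': "p (Suc k) = v * p k - \<mu> * c (Suc k) - d k" for k
    unfolding p_def rec \<mu>_def by (simp add: algebra_simps)
  \<comment> \<open>Completing the square, \<open>e (Suc k)\<close> equals \<open>(p (Suc k) + \<mu>
    * c (Suc k))\<^sup>2 + (\<mu> - \<mu>\<^sup>2) * (c (Suc k))\<^sup>2\<close>, and the first
    bracket is \<open>v * p k - d k\<close>. The weights are chosen so that no cross term between
    \<open>p k\<close> and \<open>c (Suc k)\<close> survives.\<close>
  have energy: "e (Suc k) - e k = (v * p k - d k)\<^sup>2 - (1 - \<mu>) * (p k)\<^sup>2 - \<mu>\<^sup>2 * (c (Suc k))\<^sup>2" for k
  proof -
    have c'': "c (Suc (Suc k)) = c (Suc k) + (v * p k - \<mu> * c (Suc k) - d k)"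
      unfolding p'[symmetric] by (simp add: p_def)
    show ?thesis unfolding e_def p' c'' by (simp add: algebra_simps power2_eq_square)
  qed
  define \<tau> where "\<tau> = 1 - v"
  have \<tau>: "0 < \<tau>" "\<tau> < 1" using v by (auto simp: \<tau>_def)
  show ?thesis
  proof (cases "\<theta> \<le> 1 / 3 \<or> 1 / 2 \<le> v")
    case True
    define D where "D = 1 - v\<^sup>2 - \<mu>"
    have "\<tau> / 2 \<le> D"
      using True
    proof
      assume "1 / 2 \<le> v"
      then have "\<tau> * (1 / 2) \<le> \<tau> * v" using \<tau> by (intro mult_left_mono) auto
      moreover have "D \<ge> \<tau> * v" unfolding D_def \<tau>_def using \<mu>1 by (simp add: algebra_simps power2_eq_square)
      ultimately show ?thesis by simp
    next
      assume \<theta>3: "\<theta> \<le> 1 / 3"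
      have "(1 - \<theta>) * \<mu> \<le> (1 - \<theta>) * (\<tau> / 2)"
      proof -
        have "\<theta> * \<tau> \<le> ((1 - \<theta>) / 2) * \<tau>" using \<theta>3 \<tau> by (intro mult_right_mono) auto
        then show ?thesis unfolding \<mu>\<theta> by (simp add: \<tau>_def)
      qed
      then have "\<mu> \<le> \<tau> / 2" using \<theta> by simp
      moreover have "0 \<le> v * \<tau>" using v \<tau> by simp
      moreover have "v\<^sup>2 = v - v * \<tau>" by (simp add: \<tau>_def algebra_simps power2_eq_square)
      ultimately show ?thesis unfolding D_def using \<tau>_def by linarith
    qed
    then have D: "\<tau> / 2 \<le> D" "0 < D" using \<tau> by auto
    have "e (Suc k) + D / 2 * (p k)\<^sup>2 \<le> e k + (2 / D + 1) * (d k)\<^sup>2" for k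
    proof -
      \<comment> \<open>Young's inequality as an identity: half of the dissipation \<open>D\<close>
        pays for the cross term between \<open>p k\<close> and \<open>d k\<close>.\<close>
      have "D / 2 * x\<^sup>2 + 2 / D * y\<^sup>2 + 2 * x * y = (D * x + 2 * y)\<^sup>2 / (2 * D)" for x y
        using D by (simp add: field_simps power2_eq_square)
      from this[of "p k" "v * d k"]
      have "D / 2 * (p k)\<^sup>2 + 2 / D * (v * d k)\<^sup>2 + 2 * p k * (v * d k) = (D * p k + 2 * (v * d k))\<^sup>2 / (2 * D)" .
      moreover have "0 \<le> (D * p k + 2 * (v * d k))\<^sup>2 / (2 * D)" using D by simp
      moreover have "2 / D * (v * d k)\<^sup>2 \<le> 2 / D * (d k)\<^sup>2"
        using D v by (intro mult_left_mono) (auto simp: power_mult_distrib mult_left_le_one_le power_le_one)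
      moreover have "(v * p k - d k)\<^sup>2 = v\<^sup>2 * (p k)\<^sup>2 - 2 * (p k) * (v * d k) + (d k)\<^sup>2"
        by (simp add: algebra_simps power2_eq_square)
      moreover have "0 \<le> \<mu>\<^sup>2 * (c (Suc k))\<^sup>2" by simp
      moreover have "(1 - \<mu>) * (p k)\<^sup>2 = v\<^sup>2 * (p k)\<^sup>2 + D * (p k)\<^sup>2"
        by (simp add: D_def left_diff_distrib)
      moreover have "D * (p k)\<^sup>2 = 2 * (D / 2 * (p k)\<^sup>2)" by simp
      moreover have "(2 / D + 1) * (d k)\<^sup>2 = 2 / D * (d k)\<^sup>2 + (d k)\<^sup>2"
        by (simp add: distrib_right)
      ultimately show ?thesis
        using energy[of k] by linarith
    qed
    then have "(\<Sum>k<K. D / 2 * (p k)\<^sup>2) \<le> e 0 + (\<Sum>k<K. (2 / D + 1) * (d k)\<^sup>2)" for K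
      using e0 by (intro dissipation_sum_le)
    then have "D / 2 * (\<Sum>k<K. (p k)\<^sup>2) \<le> e 0 + (2 / D + 1) * (\<Sum>k<K. (d k)\<^sup>2)" for K
      by (simp only: sum_distrib_left)
    then have "2 / D * (D / 2 * (\<Sum>k<K. (p k)\<^sup>2)) \<le> 2 / D * (e 0 + (2 / D + 1) * (\<Sum>k<K. (d k)\<^sup>2))" for K
      using D by (intro mult_left_mono) auto
    moreover have "2 / D * (e 0 + (2 / D + 1) * s) = 2 / D * e 0 + (4 / D\<^sup>2 + 2 / D) * s" for s
      by (simp add: algebra_simps power2_eq_square)
    ultimately have "(\<Sum>k<K. (p k)\<^sup>2) \<le> 2 / D * e 0 + (4 / D\<^sup>2 + 2 / D) * (\<Sum>k<K. (d k)\<^sup>2)" for K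
      using D by simp
    \<comment> \<open>The two terms are at most \<open>16 / \<tau>\<^sup>2\<close> and
      \<open>4 / \<tau>\<^sup>2\<close>; the larger constant 192 comes from the other case.\<close>
    moreover have "(4 / D\<^sup>2 + 2 / D) * (\<Sum>k<K. (d k)\<^sup>2) \<le> 192 / \<tau>\<^sup>2 * (\<Sum>k<K. (d k)\<^sup>2)" for K
    proof (intro mult_right_mono sum_nonneg)
      have "4 / D\<^sup>2 \<le> 4 / (\<tau> / 2)\<^sup>2"
        using D \<tau> by (intro divide_left_mono power_mono) auto
      also have "\<dots> = 16 * (1 / \<tau>\<^sup>2)" by (simp add: power_divide)
      finally have "4 / D\<^sup>2 \<le> 16 * (1 / \<tau>\<^sup>2)" .
      moreover have "2 / D \<le> 2 / (\<tau> / 2)"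
        using D \<tau> by (intro divide_left_mono) auto
      moreover have "2 / (\<tau> / 2) \<le> 4 * (1 / \<tau>\<^sup>2)"
        using \<tau> by (simp add: field_simps power2_eq_square)
      moreover have "0 < 1 / \<tau>\<^sup>2" using \<tau> by simp
      ultimately have "4 / D\<^sup>2 + 2 / D \<le> 192 * (1 / \<tau>\<^sup>2)" by linarith
      then show "4 / D\<^sup>2 + 2 / D \<le> 192 / \<tau>\<^sup>2" by simp
    qed simp
    ultimately have "(\<Sum>k<K. (p k)\<^sup>2) \<le> 2 / D * e 0 + 192 / \<tau>\<^sup>2 * (\<Sum>k<K. (d k)\<^sup>2)" for K
      by (meson add_left_mono order_trans)
    then show ?thesis unfolding p_def \<tau>_def by blast
  next
    case False
    \<comment> \<open>Here \<open>D\<close> can be as small as \<open>v * \<tau>\<close>, too weak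
      for small \<open>v\<close>. Instead the dissipation of \<open>c (Suc k)\<close> is summed, and
      \<open>p\<close> is bounded by two consecutive values of \<open>c\<close>.\<close>
    then have \<theta>3: "1 / 3 < \<theta>" and v2: "v < 1 / 2" by auto
    have "(1 - \<theta>) * (\<tau> / 2) \<le> (1 - \<theta>) * \<mu>"
    proof -
      have "((1 - \<theta>) / 2) * \<tau> \<le> \<theta> * \<tau>" using \<theta>3 \<tau> by (intro mult_right_mono) auto
      then show ?thesis unfolding \<mu>\<theta> by (simp add: \<tau>_def)
    qed
    then have "\<mu> \<ge> \<tau> / 2" using \<theta> by simp
    then have \<mu>4: "\<mu> \<ge> 1 / 4" using v2 by (simp add: \<tau>_def)
    have "e (Suc k) + 1 / 16 * (c (Suc k))\<^sup>2 \<le> e k + 3 * (d k)\<^sup>2" for k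
    proof -
      have "(1 / 4)\<^sup>2 \<le> \<mu>\<^sup>2" using \<mu>4 by (intro power_mono) auto
      then have "1 / 16 * (c (Suc k))\<^sup>2 \<le> \<mu>\<^sup>2 * (c (Suc k))\<^sup>2"
        by (intro mult_right_mono) (auto simp: power2_eq_square)
      moreover have "(v * p k - d k)\<^sup>2 \<le> (1 - \<mu>) * (p k)\<^sup>2 + 3 * (d k)\<^sup>2"
      proof -
        \<comment> \<open>From \<open>v < 1 / 2\<close> one gets
          \<open>v\<^sup>2 + v / 2 \<le> v \<le> 1 - \<mu>\<close>; the spare \<open>v / 2\<close>
          absorbs the cross term.\<close>
        have "v * (2 * v) \<le> v * 1" using v v2 by (intro mult_left_mono) auto
        then have "v\<^sup>2 + v / 2 \<le> 1 - \<mu>" using \<mu>1 by (simp add: power2_eq_square)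
        then have "(v\<^sup>2 + v / 2) * (p k)\<^sup>2 \<le> (1 - \<mu>) * (p k)\<^sup>2" by (intro mult_right_mono) auto
        moreover have "(v * p k - d k)\<^sup>2 = (v\<^sup>2 + v / 2) * (p k)\<^sup>2 - v / 2 * (p k + 2 * d k)\<^sup>2 + 2 * v * (d k)\<^sup>2 + (d k)\<^sup>2"
          by (simp add: algebra_simps power2_eq_square)
        moreover have "0 \<le> v / 2 * (p k + 2 * d k)\<^sup>2" using v by simp
        moreover have "2 * v * (d k)\<^sup>2 \<le> 2 * (d k)\<^sup>2" using v(3) by (intro mult_right_mono) auto
        ultimately show ?thesis by linarith
      qed
      ultimately show ?thesis using energy[of k] by linarith
    qed
    then have "(\<Sum>k<K. 1 / 16 * (c (Suc k))\<^sup>2) \<le> e 0 + (\<Sum>k<K. 3 * (d k)\<^sup>2)" for K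
      using e0 by (intro dissipation_sum_le)
    then have cs: "(\<Sum>k<K. (c (Suc k))\<^sup>2) \<le> 16 * e 0 + 48 * (\<Sum>k<K. (d k)\<^sup>2)" for K
      by (simp add: sum_distrib_left[symmetric] sum_divide_distrib[symmetric] field_simps)
    \<comment> \<open>Both sums of squares of \<open>c\<close> carry a factor 2, and shifting the
      index costs only \<open>(c 0)\<^sup>2\<close>; thus 192 is 2 * 48 + 2 * 48.\<close>
    have "(\<Sum>k<K. (p k)\<^sup>2) \<le> (64 * e 0 + 2 * (c 0)\<^sup>2) + 192 / \<tau>\<^sup>2 * (\<Sum>k<K. (d k)\<^sup>2)" for K
    proof -
      have "(p k)\<^sup>2 \<le> 2 * (c (Suc k))\<^sup>2 + 2 * (c k)\<^sup>2" for k
        unfolding p_def using sum_squares_bound[of "c (Suc k)" "- c k"]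
        by (simp add: power2_eq_square algebra_simps)
      then have "(\<Sum>k<K. (p k)\<^sup>2) \<le> (\<Sum>k<K. 2 * (c (Suc k))\<^sup>2 + 2 * (c k)\<^sup>2)" by (rule sum_mono)
      also have "\<dots> = 2 * (\<Sum>k<K. (c (Suc k))\<^sup>2) + 2 * (\<Sum>k<K. (c k)\<^sup>2)"
        by (simp add: sum.distrib sum_distrib_left)
      finally have "(\<Sum>k<K. (p k)\<^sup>2) \<le> 2 * (\<Sum>k<K. (c (Suc k))\<^sup>2) + 2 * (\<Sum>k<K. (c k)\<^sup>2)" .
      moreover have "(\<Sum>k<K. (c k)\<^sup>2) \<le> (c 0)\<^sup>2 + (\<Sum>k<K. (c (Suc k))\<^sup>2)"
        using sum.lessThan_Suc_shift[of "\<lambda>k. (c k)\<^sup>2" K]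
          sum.lessThan_Suc[of "\<lambda>k. (c k)\<^sup>2" K] zero_le_power2[of "c K"] by linarith
      ultimately have "(\<Sum>k<K. (p k)\<^sup>2) \<le> 64 * e 0 + 2 * (c 0)\<^sup>2 + 192 * (\<Sum>k<K. (d k)\<^sup>2)"
        using cs[of K] by linarith
      moreover have "192 * (\<Sum>k<K. (d k)\<^sup>2) \<le> 192 / \<tau>\<^sup>2 * (\<Sum>k<K. (d k)\<^sup>2)"
        using \<tau> by (intro mult_right_mono sum_nonneg) (auto simp: field_simps power_le_one)
      ultimately show ?thesis by linarith
    qed
    then show ?thesis unfolding p_def \<tau>_def by blast
  qed
qed

section \<open>Spectral theory\<close>

text \<open>A maximiser \<open>b\<close> of the Rayleigh quotient on the unit sphere of
  \<open>S\<close> is an eigenvector: the form \<open>q\<close> is nonnegative on \<open>S\<close>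
  and vanishes at \<open>b\<close>, so its first variation along the residual
  \<open>r = T b - w *\<^sub>R b\<close> must vanish, and that variation is a multiple of
  \<open>r \<bullet> r\<close>.\<close>

lemma self_adjoint_invariant_subspace_eigenvector:
  fixes T :: "'a::euclidean_space \<Rightarrow> 'a"
  assumes T: "linear T" and adj: "\<And>x y. T x \<bullet> y = x \<bullet> T y"
    and S: "subspace S" "T ` S \<subseteq> S" "\<not> S \<subseteq> {0}"
  shows "\<exists>b\<in>S. norm b = 1 \<and> (\<exists>w. T b = w *\<^sub>R b)"
proof -
  interpret linear T by fact
  have "compact (sphere 0 1 \<inter> S)"
    using S(1) by (intro compact_Int_closed closed_subspace) auto
  moreover from S obtain x where "x \<in> S" "x \<noteq> 0" by auto
  then have "x /\<^sub>R norm x \<in> sphere 0 1 \<inter> S"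
    using S(1) by (auto intro: subspace_scale)
  then have "sphere 0 1 \<inter> S \<noteq> {}" by blast
  moreover have "continuous_on (sphere 0 1 \<inter> S) (\<lambda>x. x \<bullet> T x)"
    using T by (intro continuous_intros linear_continuous_on) (simp add: linear_conv_bounded_linear)
  ultimately obtain b where b: "b \<in> sphere 0 1 \<inter> S"
    and max: "\<And>y. y \<in> sphere 0 1 \<inter> S \<Longrightarrow> y \<bullet> T y \<le> b \<bullet> T b"
    using continuous_attains_sup by metis
  define w where "w = b \<bullet> T b"
  define q where "q x = w * (x \<bullet> x) - x \<bullet> T x" for x
  have bb: "b \<bullet> b = 1" using b by (simp add: dot_square_norm)
  have q: "0 \<le> q x" if "x \<in> S" for x
  proof (cases "x = 0")
    case False
    have "x /\<^sub>R norm x \<in> sphere 0 1 \<inter> S"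
      using that False S(1) by (auto intro: subspace_scale)
    from max[OF this] have "(x \<bullet> T x) / (norm x)\<^sup>2 \<le> w"
      by (simp add: scaleR w_def power2_eq_square divide_inverse mult_ac)
    then show ?thesis
      using False by (simp add: q_def dot_square_norm divide_le_eq)
  qed (simp add: q_def)
  define r where "r = T b - w *\<^sub>R b"
  have r: "r \<in> S" unfolding r_def using b S by (auto intro!: subspace_diff subspace_scale)
  have expand: "q (b + t *\<^sub>R r) = - 2 * t * (r \<bullet> r) + t\<^sup>2 * q r" for t
  proof -
    have "b \<bullet> T r = T b \<bullet> r" by (simp add: adj)
    moreover have "r \<bullet> T b = T b \<bullet> r" by (simp add: inner_commute)
    moreover have "r \<bullet> b = b \<bullet> r" by (simp add: inner_commute)
    moreover have "r \<bullet> r = T b \<bullet> r - w * (b \<bullet> r)" by (simp add: r_def inner_diff_left)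
    ultimately show ?thesis
      unfolding q_def by (simp add: add scaleR inner_add_left inner_add_right bb flip: w_def)
        (simp add: algebra_simps power2_eq_square)
  qed
  have "r \<bullet> r = 0"
  proof (rule ccontr)
    assume "r \<bullet> r \<noteq> 0"
    then have pos: "0 < r \<bullet> r" by simp
    \<comment> \<open>This choice gives \<open>t * q r < r \<bullet> r\<close>, so the quadratic
      term cannot outweigh the linear one; the added 1 keeps the denominator positive when
      \<open>q r = 0\<close>.\<close>
    define t where "t = (r \<bullet> r) / (q r + 1)"
    have t: "0 < t" "t * (q r + 1) = r \<bullet> r" using pos q[OF r] by (auto simp: t_def)
    have "0 \<le> q (b + t *\<^sub>R r)"
      using b r S(1) by (intro q) (auto intro!: subspace_add subspace_scale)
    then have "0 \<le> t * (t * q r - 2 * (r \<bullet> r))"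
      unfolding expand by (simp add: algebra_simps power2_eq_square)
    then have "2 * (r \<bullet> r) \<le> t * q r" using t(1) by (simp add: zero_le_mult_iff)
    with t pos show False by (simp add: algebra_simps)
  qed
  then show ?thesis using b unfolding r_def by (auto simp: dot_square_norm)
qed

text \<open>An orthonormal set of eigenvectors of greatest cardinality must span: its orthogonal
  complement is invariant under \<open>T\<close>, so a nonzero complement would supply one more
  eigenvector.\<close>

theorem self_adjoint_orthonormal_eigenbasis:
  fixes T :: "'a::euclidean_space \<Rightarrow> 'a"
  assumes T: "linear T" and adj: "\<And>x y. T x \<bullet> y = x \<bullet> T y"
  obtains B where "finite B" "pairwise orthogonal B" "\<And>b. b \<in> B \<Longrightarrow> norm b = 1"
    "span B = UNIV" "\<And>b. b \<in> B \<Longrightarrow> \<exists>w. T b = w *\<^sub>R b"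
proof -
  define ok where "ok B \<longleftrightarrow> pairwise orthogonal B \<and> (\<forall>b\<in>B. norm b = 1 \<and> (\<exists>w. T b = w *\<^sub>R b))" for B
  have bound: "finite B \<and> card B \<le> DIM('a)" if "ok B" for B
  proof -
    have "0 \<notin> B" using that by (auto simp: ok_def)
    then show ?thesis
      using that independent_bound pairwise_orthogonal_independent by (auto simp: ok_def)
  qed
  have "ok {}" by (simp add: ok_def)
  then obtain B where B: "ok B" and greatest: "\<And>B'. ok B' \<Longrightarrow> card B' \<le> card B"
    using ex_has_greatest_nat[of ok "{}" card "Suc DIM('a)"] bound by (auto simp: less_Suc_eq_le)
  have "span B = UNIV"
  proof (rule ccontr)
    assume "span B \<noteq> UNIV"
    then obtain a where a: "a \<noteq> 0" "\<forall>x\<in>span B. a \<bullet> x = 0"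
      using span_not_UNIV_orthogonal by blast
    define S where "S = {y. \<forall>x\<in>B. orthogonal x y}"
    have "a \<in> S" using a(2) by (auto simp: S_def orthogonal_def inner_commute span_base)
    then have "\<not> S \<subseteq> {0}" using a(1) by auto
    moreover have "T ` S \<subseteq> S"
    proof clarify
      fix y assume y: "y \<in> S"
      have "x \<bullet> T y = 0" if x: "x \<in> B" for x
      proof -
        obtain w where "T x = w *\<^sub>R x" using B x by (auto simp: ok_def)
        then show ?thesis using y x adj[of x y] by (simp add: S_def orthogonal_def)
      qed
      then show "T y \<in> S" by (simp add: S_def orthogonal_def)
    qed
    moreover have "subspace S" unfolding S_def by (rule subspace_orthogonal_to_vectors)
    ultimately obtain b where b: "b \<in> S" "norm b = 1" "\<exists>w. T b = w *\<^sub>R b"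
      using self_adjoint_invariant_subspace_eigenvector[OF T adj] by blast
    have "b \<notin> B" using b by (auto simp: S_def orthogonal_def)
    moreover have "ok (insert b B)"
      using B b by (auto simp: ok_def S_def pairwise_insert orthogonal_commute)
    ultimately show False
      using greatest[of "insert b B"] bound[OF B] by simp
  qed
  with that[of B] B bound show ?thesis by (auto simp: ok_def)
qed

text \<open>The Gram-Schmidt residual of \<open>x\<close> is orthogonal to the whole space, in
  particular to itself.\<close>

lemma orthonormal_basis_expansion:
  fixes x :: "'a::euclidean_space"
  assumes "pairwise orthogonal B" "\<And>b. b \<in> B \<Longrightarrow> norm b = 1" "span B = UNIV"
  shows "(\<Sum>b\<in>B. (x \<bullet> b) *\<^sub>R b) = x"
proof -
  define r where "r = x - (\<Sum>b\<in>B. (b \<bullet> x / (b \<bullet> b)) *\<^sub>R b)"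
  have "orthogonal r r"
    using Gram_Schmidt_step[OF assms(1), of r x] assms(3) by (simp add: r_def)
  then have "x = (\<Sum>b\<in>B. (b \<bullet> x / (b \<bullet> b)) *\<^sub>R b)" by (simp add: orthogonal_self r_def)
  also have "\<dots> = (\<Sum>b\<in>B. (x \<bullet> b) *\<^sub>R b)"
    by (intro sum.cong refl) (simp add: dot_square_norm assms(2) inner_commute)
  finally show ?thesis by simp
qed

lemma orthonormal_basis_norm_sum:
  fixes x :: "'a::euclidean_space"
  assumes "pairwise orthogonal B" "\<And>b. b \<in> B \<Longrightarrow> norm b = 1" "span B = UNIV"
  shows "(norm x)\<^sup>2 = (\<Sum>b\<in>B. (x \<bullet> b)\<^sup>2)"
proof -
  have "(norm x)\<^sup>2 = x \<bullet> (\<Sum>b\<in>B. (x \<bullet> b) *\<^sub>R b)"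
    by (simp add: orthonormal_basis_expansion[OF assms] dot_square_norm)
  then show ?thesis by (simp add: inner_sum_right power2_eq_square)
qed

lemma matrix_vector_mult_scale_sum:
  fixes M :: "'b::field ^ 'm ^ 'n"
  shows "M *v (\<Sum>i\<in>I. c i *s u i) = (\<Sum>i\<in>I. c i *s (M *v u i))"
  by (induction I rule: infinite_finite_induct)
    (simp_all add: matrix_vector_right_distrib vector_scalar_commute)

text \<open>Applying \<open>M\<close> minus \<open>a\<close> to a linear relation kills the
  \<open>u a\<close> term and multiplies every other coefficient by the nonzero factor
  \<open>z - a\<close>, which reduces the relation to a smaller set.\<close>

lemma eigenvectors_distinct_eigenvalues_independent:
  fixes M :: "complex ^ 'a ^ 'a" and u :: "complex \<Rightarrow> complex ^ 'a"
  assumes "finite Z" and "\<And>z. z \<in> Z \<Longrightarrow> u z \<noteq> 0 \<and> M *v u z = z *s u z"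
    and "(\<Sum>z\<in>Z. c z *s u z) = 0" and "z \<in> Z"
  shows "c z = 0"
  using assms
proof (induction Z arbitrary: c z rule: finite_induct)
  case (insert a Z)
  have "0 = M *v (\<Sum>z\<in>insert a Z. c z *s u z) - a *s (\<Sum>z\<in>insert a Z. c z *s u z)"
    unfolding insert.prems(2) by simp
  also have "M *v (\<Sum>z\<in>insert a Z. c z *s u z) = (\<Sum>z\<in>insert a Z. c z *s (M *v u z))"
    by (rule matrix_vector_mult_scale_sum)
  also have "\<dots> = (\<Sum>z\<in>insert a Z. c z *s (z *s u z))"
    using insert.prems(1) by (intro sum.cong) auto
  also have "\<dots> - a *s (\<Sum>z\<in>insert a Z. c z *s u z) = (\<Sum>z\<in>insert a Z. ((z - a) * c z) *s u z)"
    by (simp only: vec.scale_sum_right sum_subtractf[symmetric])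
      (intro sum.cong refl, simp add: vec_eq_iff algebra_simps)
  finally have "(\<Sum>z\<in>Z. ((z - a) * c z) *s u z) = 0"
    using insert.hyps by simp
  then have Z: "c z = 0" if "z \<in> Z" for z
    using insert.IH[of "\<lambda>z. (z - a) * c z" z] insert.prems(1) insert.hyps that by auto
  then have "c a *s u a = 0" using insert.prems(2) insert.hyps by simp
  then have "c a = 0" using insert.prems(1)[of a] by simp
  with Z insert.prems(3) show ?case by auto
qed simp

text \<open>Finiteness gives meaning to the \<open>Max\<close> in \<open>spectral_radius\<close>.
  Eigenvectors of distinct eigenvalues are independent over the complex numbers, hence over the
  reals, so the real dimension bounds their number.\<close>

lemma finite_complex_eigenvalues: "finite (complex_eigenvalues C)"
proof (rule ccontr)
  let ?M = "(\<chi> i j. complex_of_real (C $ i $ j))"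
  assume "infinite (complex_eigenvalues C)"
  then obtain Z where Z: "Z \<subseteq> complex_eigenvalues C" "finite Z" "card Z = Suc (DIM(complex ^ 'a))"
    using infinite_arbitrarily_large by metis
  have "\<forall>z\<in>Z. \<exists>v. v \<noteq> 0 \<and> ?M *v v = z *s v"
    using Z(1) by (auto simp: complex_eigenvalues_def)
  then obtain u where u: "\<And>z. z \<in> Z \<Longrightarrow> u z \<noteq> 0 \<and> ?M *v u z = z *s u z" by metis
  have inj: "inj_on u Z"
  proof (rule inj_onI)
    fix x y assume "x \<in> Z" "y \<in> Z" "u x = u y"
    then have "x *s u x = y *s u x" using u by (metis (no_types))
    with u[OF \<open>x \<in> Z\<close>] show "x = y" using vec.scale_cancel_right by blast
  qed
  have "independent (u ` Z)"
  proof (rule independent_if_scalars_zero)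
    show "finite (u ` Z)" using Z(2) by simp
    fix f x assume f: "(\<Sum>x\<in>u ` Z. f x *\<^sub>R x) = 0" and "x \<in> u ` Z"
    then obtain z where z: "x = u z" "z \<in> Z" by auto
    have "r *\<^sub>R y = complex_of_real r *s y" for r and y :: "complex ^ 'a"
      by (simp add: vec_eq_iff) (simp add: scaleR_conv_of_real)
    with f have "(\<Sum>z\<in>Z. complex_of_real (f (u z)) *s u z) = 0"
      by (simp add: sum.reindex[OF inj])
    from eigenvectors_distinct_eigenvalues_independent[OF Z(2) u this z(2)]
    show "f x = 0" by (simp add: z(1))
  qed
  then have "card (u ` Z) \<le> DIM(complex ^ 'a)" using independent_bound by blast
  with Z(3) card_image[OF inj] show False by simp
qed

lemma cmod_eigenvalue_le_spectral_radius:
  "z \<in> complex_eigenvalues C \<Longrightarrow> cmod z \<le> spectral_radius C"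
  unfolding spectral_radius_def by (simp add: finite_complex_eigenvalues)

section \<open>Gradients\<close>

lemma gradient_unique:
  assumes "GDERIV f x :> g"
  shows "gradient f x = g"
  unfolding gradient_def
proof (rule the_equality)
  show "GDERIV f x :> g" by (rule assms)
next
  fix g' assume "GDERIV f x :> g'"
  then have "(\<lambda>h. h \<bullet> g') = (\<lambda>h. h \<bullet> g)"
    using assms has_derivative_unique unfolding gderiv_def by blast
  then show "g' = g" by (metis vector_eq_ldot)
qed

text \<open>Riesz representation in coordinates: the derivative is the inner product with the vector
  of its values on the basis.\<close>

lemma GDERIV_gradient:
  fixes f :: "'a::euclidean_space \<Rightarrow> real"
  assumes "f differentiable (at x)"
  shows "GDERIV f x :> gradient f x"
proof -
  obtain f' where f': "(f has_derivative f') (at x)"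
    using assms by (auto simp: differentiable_def)
  then have lin: "linear f'" by (rule has_derivative_linear)
  have "f' h = h \<bullet> (\<Sum>b\<in>Basis. f' b *\<^sub>R b)" for h
  proof -
    have "f' h = f' (\<Sum>b\<in>Basis. (h \<bullet> b) *\<^sub>R b)" by (simp add: euclidean_representation)
    also have "\<dots> = (\<Sum>b\<in>Basis. (h \<bullet> b) * f' b)"
      using lin by (simp add: linear_sum linear_cmul)
    finally show ?thesis by (simp add: inner_sum_right mult.commute)
  qed
  then have "f' = (\<lambda>h. h \<bullet> (\<Sum>b\<in>Basis. f' b *\<^sub>R b))" by (rule ext)
  with f' have "GDERIV f x :> (\<Sum>b\<in>Basis. f' b *\<^sub>R b)"
    unfolding gderiv_def by (simp only:)
  with gradient_unique show ?thesis by metis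
qed

text \<open>The mean value theorem along the segment compares gradients at a single intermediate
  point. It yields the constant \<open>L\<close> where integration would yield
  \<open>L / 2\<close>.\<close>

lemma lipschitz_gradient_descent:
  fixes F :: "'a::euclidean_space \<Rightarrow> real"
  assumes diff: "\<And>x. F differentiable (at x)" and "0 \<le> L"
    and lip: "\<And>x y. norm (gradient F x - gradient F y) \<le> L * norm (x - y)"
  shows "F (x + h) \<le> F x + h \<bullet> gradient F x + L * (norm h)\<^sup>2"
proof -
  have der: "((\<lambda>t. F (x + t *\<^sub>R h)) has_real_derivative h \<bullet> gradient F (x + t *\<^sub>R h)) (at t)" for t
  proof -
    have "(F has_derivative (\<lambda>k. k \<bullet> gradient F (x + t *\<^sub>R h))) (at (x + t *\<^sub>R h))"
      using GDERIV_gradient[OF diff] by (simp add: gderiv_def)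
    moreover have "((\<lambda>t. x + t *\<^sub>R h) has_derivative (\<lambda>s. s *\<^sub>R h)) (at t)"
      by (auto intro!: derivative_eq_intros)
    ultimately have "((\<lambda>t. F (x + t *\<^sub>R h)) has_derivative (\<lambda>s. (s *\<^sub>R h) \<bullet> gradient F (x + t *\<^sub>R h))) (at t)"
      by (rule has_derivative_compose[rotated])
    then show ?thesis
      by (simp add: has_field_derivative_def mult_commute_abs)
  qed
  obtain t where t: "0 < t" "t < 1"
    and "F (x + 1 *\<^sub>R h) - F (x + 0 *\<^sub>R h) = (1 - 0) * (h \<bullet> gradient F (x + t *\<^sub>R h))"
    using MVT2[of 0 1 "\<lambda>t. F (x + t *\<^sub>R h)" "\<lambda>t. h \<bullet> gradient F (x + t *\<^sub>R h)"] der by auto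
  then have "F (x + h) - F x = h \<bullet> gradient F x + h \<bullet> (gradient F (x + t *\<^sub>R h) - gradient F x)"
    by (simp add: inner_diff_right)
  also have "h \<bullet> (gradient F (x + t *\<^sub>R h) - gradient F x) \<le> norm h * (L * norm (t *\<^sub>R h))"
  proof -
    have "h \<bullet> (gradient F (x + t *\<^sub>R h) - gradient F x)
        \<le> norm h * norm (gradient F (x + t *\<^sub>R h) - gradient F x)"
      by (rule norm_cauchy_schwarz)
    also have "\<dots> \<le> norm h * (L * norm (t *\<^sub>R h))"
      using lip[of "x + t *\<^sub>R h" x] by (intro mult_left_mono) auto
    finally show ?thesis .
  qed
  also have "\<dots> = t * (L * (norm h)\<^sup>2)"
    using t by (simp add: power2_eq_square)
  also have "\<dots> \<le> L * (norm h)\<^sup>2"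
    using t \<open>0 \<le> L\<close> by (intro mult_left_le_one_le) auto
  finally show ?thesis by simp
qed

lemma inner_block:
  fixes x y :: "real ^ ('m::finite \<times> 'n::finite)"
  shows "x \<bullet> y = (\<Sum>i\<in>UNIV. block x i \<bullet> block y i)"
proof -
  have "x \<bullet> y = (\<Sum>p\<in>UNIV \<times> UNIV. x $ p * y $ p)"
    by (simp add: inner_vec_def)
  also have "\<dots> = (\<Sum>i\<in>UNIV. block x i \<bullet> block y i)"
    unfolding sum.cartesian_product' by (simp add: inner_vec_def block_def)
  finally show ?thesis .
qed

lemma GDERIV_stacked_sum:
  fixes f :: "'m::finite \<Rightarrow> real ^ 'n::finite \<Rightarrow> real"
  assumes diff: "\<And>i x. f i differentiable (at x)"
  shows "GDERIV (stacked_sum f) x :> (\<chi> p. gradient (f (fst p)) (block x (fst p)) $ snd p)"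
proof -
  have "((\<lambda>x. f i (block x i)) has_derivative (\<lambda>h. block h i \<bullet> gradient (f i) (block x i))) (at x)" for i
  proof -
    have "linear (\<lambda>x :: real ^ ('m \<times> 'n). block x i)"
      by (intro linearI) (simp_all add: block_def vec_eq_iff)
    then have "((\<lambda>x. block x i) has_derivative (\<lambda>h. block h i)) (at x)"
      by (simp add: linear_conv_bounded_linear bounded_linear_imp_has_derivative)
    moreover have "(f i has_derivative (\<lambda>k. k \<bullet> gradient (f i) (block x i))) (at (block x i))"
      using GDERIV_gradient[OF diff] by (simp add: gderiv_def)
    ultimately show ?thesis by (rule has_derivative_compose)
  qed
  then have "(stacked_sum f has_derivative (\<lambda>h. \<Sum>i\<in>UNIV. block h i \<bullet> gradient (f i) (block x i))) (at x)"
    unfolding stacked_sum_def by (intro has_derivative_sum)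
  then show ?thesis
    unfolding gderiv_def inner_block by (simp add: block_def)
qed

lemma block_gradient_stacked_sum:
  fixes f :: "'m::finite \<Rightarrow> real ^ 'n::finite \<Rightarrow> real"
  assumes "\<And>i x. f i differentiable (at x)"
  shows "block (gradient (stacked_sum f) x) i = gradient (f i) (block x i)"
  unfolding gradient_unique[OF GDERIV_stacked_sum[OF assms]] by (simp add: block_def)

text \<open>Squared norms add over blocks and each block of the gradient depends on its own block
  only, so no factor depending on the number of blocks appears.\<close>

lemma stacked_sum_gradient_lipschitz:
  fixes f :: "'m::finite \<Rightarrow> real ^ 'n::finite \<Rightarrow> real"
  assumes diff: "\<And>i x. f i differentiable (at x)" and "0 \<le> L"
    and lip: "\<And>i x y. norm (gradient (f i) x - gradient (f i) y) \<le> L * norm (x - y)"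
  shows "norm (gradient (stacked_sum f) x - gradient (stacked_sum f) y) \<le> L * norm (x - y)"
proof (rule power2_le_imp_le)
  let ?g = "gradient (stacked_sum f)"
  have block_diff: "block (u - v) i = block u i - block v i" for u v :: "real ^ ('m \<times> 'n)" and i
    by (simp add: block_def vec_eq_iff)
  have "(norm (?g x - ?g y))\<^sup>2 = (\<Sum>i\<in>UNIV. (norm (gradient (f i) (block x i) - gradient (f i) (block y i)))\<^sup>2)"
    unfolding power2_norm_eq_inner
    by (subst inner_block) (simp add: block_diff block_gradient_stacked_sum[OF diff])
  also have "\<dots> \<le> (\<Sum>i\<in>UNIV. (L * norm (block x i - block y i))\<^sup>2)"
    by (intro sum_mono power_mono lip norm_ge_zero)
  also have "\<dots> = (L * norm (x - y))\<^sup>2"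
    unfolding power_mult_distrib power2_norm_eq_inner
    by (subst inner_block[of "x - y"]) (simp add: block_diff sum_distrib_left)
  finally show "(norm (?g x - ?g y))\<^sup>2 \<le> (L * norm (x - y))\<^sup>2" .
qed (simp add: \<open>0 \<le> L\<close>)

text \<open>The minimum over the compact sublevel set at height \<open>f 0\<close> is global, since
  \<open>f\<close> exceeds \<open>f 0\<close> elsewhere.\<close>

lemma coercive_bounded_below:
  assumes cont: "continuous_on UNIV f" and "coercive f"
  shows "\<exists>m. \<forall>x. m \<le> f x"
proof -
  define S where "S = {x. f x \<le> f 0}"
  have "compact S" using assms(2) by (simp add: coercive_def S_def)
  moreover have "0 \<in> S" by (simp add: S_def)
  moreover have "continuous_on S f" using cont continuous_on_subset by blast
  ultimately obtain y where y: "\<And>x. x \<in> S \<Longrightarrow> f y \<le> f x" "y \<in> S"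
    using continuous_attains_inf[of S f] by blast
  have "f y \<le> f x" for x
    using y(1)[of x] y(1)[of 0] by (cases "x \<in> S") (auto simp: S_def)
  then show ?thesis by blast
qed

lemma stacked_sum_bounded_below:
  assumes "\<And>i. \<exists>m. \<forall>x. m \<le> f i x"
  shows "\<exists>m. \<forall>x. m \<le> stacked_sum f x"
proof -
  obtain m where "\<And>i x. m i \<le> f i x" using assms by metis
  then show ?thesis
    unfolding stacked_sum_def by (intro exI[of _ "\<Sum>i\<in>UNIV. m i"]) (simp add: sum_mono)
qed

section \<open>Kronecker products and the matrix \<open>P\<close>\<close>

text \<open>The counterpart of \<open>block\<close>: it fixes the coordinate and varies the agent,
  because \<open>A \<otimes>\<^sub>K mat 1\<close> acts on every such slice as
  \<open>A\<close>.\<close>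

definition coord_slice :: "real ^ ('m::finite \<times> 'n::finite) \<Rightarrow> 'n \<Rightarrow> real ^ 'm" where
  "coord_slice x j = (\<chi> i. x $ (i, j))"

lemma kronecker_mat_1_mult_component:
  fixes x :: "real ^ ('m::finite \<times> 'n::finite)"
  shows "((A \<otimes>\<^sub>K mat 1) *v x) $ (i, j) = (A *v coord_slice x j) $ i"
proof -
  have "((A \<otimes>\<^sub>K mat 1) *v x) $ (i, j)
      = (\<Sum>q\<in>UNIV \<times> UNIV. A $ i $ fst q * (mat 1 :: real ^ 'n ^ 'n) $ j $ snd q * x $ q)"
    by (simp add: matrix_vector_mult_def kronecker_def)
  also have "\<dots> = (\<Sum>k\<in>UNIV. \<Sum>l\<in>UNIV. if l = j then A $ i $ k * x $ (k, l) else 0)"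
    unfolding sum.cartesian_product' by (intro sum.cong refl) (simp add: mat_def)
  also have "\<dots> = (A *v coord_slice x j) $ i"
    by (simp add: matrix_vector_mult_def coord_slice_def)
  finally show ?thesis .
qed

lemma coord_slice_kronecker:
  fixes x :: "real ^ ('m::finite \<times> 'n::finite)"
  shows "coord_slice ((A \<otimes>\<^sub>K mat 1) *v x) j = A *v coord_slice x j"
  by (subst coord_slice_def) (simp add: vec_eq_iff kronecker_mat_1_mult_component)

lemma coord_slice_eqI: "(\<And>j. coord_slice x j = coord_slice y j) \<Longrightarrow> x = y"
  by (auto simp: coord_slice_def vec_eq_iff)

lemma coord_slice_linear [simp]:
  "coord_slice (x + y) j = coord_slice x j + coord_slice y j"
  "coord_slice (x - y) j = coord_slice x j - coord_slice y j"
  "coord_slice (c *\<^sub>R x) j = c *\<^sub>R coord_slice x j"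
  "coord_slice 0 j = 0"
  by (simp_all add: coord_slice_def vec_eq_iff)

lemma inner_coord_slice:
  fixes x y :: "real ^ ('m::finite \<times> 'n::finite)"
  shows "x \<bullet> y = (\<Sum>j\<in>UNIV. coord_slice x j \<bullet> coord_slice y j)"
proof -
  have "x \<bullet> y = (\<Sum>p\<in>UNIV \<times> UNIV. x $ p * y $ p)"
    by (simp add: inner_vec_def)
  also have "\<dots> = (\<Sum>i\<in>UNIV. \<Sum>j\<in>UNIV. x $ (i, j) * y $ (i, j))"
    unfolding sum.cartesian_product' ..
  finally show ?thesis
    by (subst (asm) sum.swap) (simp add: inner_vec_def coord_slice_def)
qed

lemma symmetric_kronecker_mat_1_self_adjoint:
  fixes x y :: "real ^ ('m::finite \<times> 'n::finite)"
  assumes "transpose A = A"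
  shows "((A \<otimes>\<^sub>K mat 1) *v x) \<bullet> y = x \<bullet> ((A \<otimes>\<^sub>K mat 1) *v y)"
  unfolding inner_coord_slice coord_slice_kronecker
  by (intro sum.cong refl) (metis assms dot_lmul_matrix matrix_vector_mult_def transpose_matrix_vector)

lemma avg_matrix_component: "avg_matrix $ i $ j = 1 / real CARD('m)"
  for i j :: "'m::finite"
  by (simp add: avg_matrix_def columnvector_def rowvector_def matrix_matrix_mult_def)

lemma avg_matrix_mult: "avg_matrix *v q = ((q \<bullet> vec 1) / real CARD('m)) *\<^sub>R vec 1"
  for q :: "real ^ 'm::finite"
  by (simp add: vec_eq_iff matrix_vector_mult_def avg_matrix_component inner_vec_def
      sum_divide_distrib)

lemma avg_matrix_mult_span:
  "avg_matrix *v q = q" if "q \<in> span {vec 1}" for q :: "real ^ 'm::finite"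
proof -
  obtain c where "q = c *\<^sub>R vec 1" using \<open>q \<in> span {vec 1}\<close> by (auto simp: span_singleton)
  then show ?thesis by (simp add: avg_matrix_mult inner_vec_def)
qed

text \<open>
  On an eigenvector \<open>q\<close> of \<open>W\<close> orthogonal to \<open>1\<close>, \<open>P\<close> acts on pairs \<open>(q, r q)\<close> as a \<open>2 \<times> 2\<close> matrix
  whose characteristic polynomial is \<open>z\<^sup>2 - (1 + w) z + v\<close>.
\<close>

lemma root_in_complex_eigenvalues_P_matrix:
  fixes W V :: "real ^ 'm ^ 'm::finite"
  assumes W: "W *v q = w *\<^sub>R q" and V: "V *v q = v *\<^sub>R q"
    and q: "avg_matrix *v q = 0" "q \<noteq> 0"
    and z: "z\<^sup>2 - of_real (1 + w) * z + of_real v = 0"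
  shows "z \<in> complex_eigenvalues (P_matrix W V)"
proof -
  \<comment> \<open>The factor \<open>z - w\<close> is forced by the first block row,
    \<open>w + r = z\<close>. The second block row then requires \<open>z - v = z * (z - w)\<close>,
    which is the characteristic equation.\<close>
  define Q :: "complex ^ ('m + 'm)" where
    "Q = (\<chi> p. case p of Inl i \<Rightarrow> of_real (q $ i) | Inr i \<Rightarrow> (z - of_real w) * of_real (q $ i))"
  let ?P = "\<chi> i j. complex_of_real (P_matrix W V $ i $ j)"
  have sum_Plus: "(\<Sum>p\<in>UNIV. h p) = (\<Sum>i\<in>UNIV. h (Inl i)) + (\<Sum>i\<in>UNIV. h (Inr i))"
    for h :: "'m + 'm \<Rightarrow> complex"
    unfolding UNIV_Plus_UNIV[symmetric] by (subst sum.Plus) auto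
  have mult: "(\<Sum>j\<in>UNIV. complex_of_real (A $ i $ j) * of_real (q $ j)) = of_real ((A *v q) $ i)"
    for A :: "real ^ 'm ^ 'm" and i
    by (simp add: matrix_vector_mult_def)
  have mult': "(\<Sum>j\<in>UNIV. complex_of_real (A $ i $ j) * (c * of_real (q $ j))) = c * of_real ((A *v q) $ i)"
    for A :: "real ^ 'm ^ 'm" and i c
    by (simp add: mult[symmetric] sum_distrib_left mult_ac)
  have PQ: "(?P *v Q) $ p = (\<Sum>j\<in>UNIV. ?P $ p $ Inl j * Q $ Inl j) + (\<Sum>j\<in>UNIV. ?P $ p $ Inr j * Q $ Inr j)" for p
    unfolding matrix_vector_mult_def[of ?P] by (simp add: sum_Plus)
  have "(?P *v Q) $ p = (z *s Q) $ p" for p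
  proof (cases p)
    case (Inl i)
    have "(?P *v Q) $ p = of_real (((W - avg_matrix) *v q) $ i) + (z - of_real w) * of_real ((mat 1 *v q) $ i)"
      unfolding mult'[symmetric] unfolding mult[symmetric] PQ
      by (simp add: Inl P_matrix_def block_matrix_def Q_def)
    then show ?thesis
      by (simp add: Inl Q_def matrix_vector_mult_diff_rdistrib W q algebra_simps)
  next
    case (Inr i)
    have "(?P *v Q) $ p = of_real (((W - V) *v q) $ i) + (z - of_real w) * of_real (((mat 1 - avg_matrix) *v q) $ i)"
      unfolding mult'[symmetric] unfolding mult[symmetric] PQ
      by (simp add: Inr P_matrix_def block_matrix_def Q_def)
    also have "\<dots> = (z - of_real v) * of_real (q $ i)"
      by (simp add: matrix_vector_mult_diff_rdistrib W V q algebra_simps)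
    also have "z - of_real v = z * (z - of_real w)"
      using z by (simp add: algebra_simps power2_eq_square)
    finally show ?thesis by (simp add: Inr Q_def)
  qed
  then have "?P *v Q = z *s Q" by (simp add: vec_eq_iff)
  moreover have "Q \<noteq> 0"
  proof -
    obtain i where "q $ i \<noteq> 0" using q(2) by (auto simp: vec_eq_iff)
    then have "Q $ Inl i \<noteq> 0" by (simp add: Q_def)
    then show ?thesis by force
  qed
  ultimately show ?thesis by (auto simp: complex_eigenvalues_def)
qed

lemma complex_sum_prod_exist:
  fixes s p :: complex
  obtains r1 r2 where "r1 + r2 = s" "r1 * r2 = p"
proof
  let ?e = "csqrt (s\<^sup>2 - 4 * p)"
  have "?e * ?e = s\<^sup>2 - 4 * p" by (simp flip: power2_eq_square)
  then show "(s + ?e) / 2 * ((s - ?e) / 2) = p"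
    by (simp add: field_simps power2_eq_square)
qed (simp add: field_simps)

section \<open>Convergence\<close>

text \<open>Passes from single modes to their total: the additive constants may differ between
  modes, the gain \<open>g\<close> is common. Absolute values make the total constant
  nonnegative.\<close>

lemma uniform_bound_sum:
  fixes a :: "'b \<Rightarrow> nat \<Rightarrow> real"
  assumes "finite A" and "\<And>b. b \<in> A \<Longrightarrow> \<exists>C. \<forall>K. a b K \<le> C + g * d b K"
  shows "\<exists>C\<ge>0. \<forall>K. (\<Sum>b\<in>A. a b K) \<le> C + g * (\<Sum>b\<in>A. d b K)"
proof -
  obtain C where C: "\<And>b K. b \<in> A \<Longrightarrow> a b K \<le> C b + g * d b K" using assms(2) by metis
  have "(\<Sum>b\<in>A. a b K) \<le> (\<Sum>b\<in>A. \<bar>C b\<bar>) + g * (\<Sum>b\<in>A. d b K)" for K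
    unfolding sum_distrib_left sum.distrib[symmetric]
    by (intro sum_mono) (use C in \<open>smt (verit)\<close>)
  then show ?thesis by (intro exI[of _ "\<Sum>b\<in>A. \<bar>C b\<bar>"]) (simp add: sum_nonneg)
qed

lemma bounded_sums_tendsto_0:
  fixes a :: "nat \<Rightarrow> real"
  assumes "\<And>k. 0 \<le> a k" "\<And>K. (\<Sum>k<K. a k) \<le> C"
  shows "a \<longlonglongrightarrow> 0"
  using summableI_nonneg_bounded[OF assms] by (rule summable_LIMSEQ_zero)

text \<open>
  \<open>A\<close> holds the consensus modes, \<open>B - A\<close> the disagreement modes. The two gain hypotheses form a
  small-gain loop with the Lipschitz bound on the forcing \<open>\<alpha> (G x\<^sub>k\<^sub>+\<^sub>1 - G x\<^sub>k)\<close>: the disagreement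
  energy is controlled by the gradient steps of the average, and descent of \<open>F\<close> along the average
  makes the latter summable.
\<close>

lemma small_gain_consensus:
  fixes x :: "nat \<Rightarrow> 'a::euclidean_space" and G :: "'a \<Rightarrow> 'a" and F :: "'a \<Rightarrow> real"
    and \<alpha> L s m :: real
  defines "d \<equiv> \<lambda>k. \<alpha> *\<^sub>R (G (x (Suc k)) - G (x k))"
  assumes B: "finite B" "pairwise orthogonal B" "\<And>b. b \<in> B \<Longrightarrow> norm b = 1" "span B = UNIV"
    and A: "A \<subseteq> B"
    and mean: "\<And>b k. b \<in> A \<Longrightarrow> x (Suc k) \<bullet> b = x k \<bullet> b - \<alpha> * (G (x k) \<bullet> b)"
    and gain: "\<And>b. b \<in> B - A \<Longrightarrow>
      \<exists>C. \<forall>K. (\<Sum>k<K. (x k \<bullet> b)\<^sup>2) \<le> C + 1 / s ^ 4 * (\<Sum>k<K. (d k \<bullet> b)\<^sup>2)"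
    and gain_diff: "\<And>b. b \<in> B - A \<Longrightarrow>
      \<exists>C. \<forall>K. (\<Sum>k<K. (x (Suc k) \<bullet> b - x k \<bullet> b)\<^sup>2) \<le> C + 192 / s\<^sup>2 * (\<Sum>k<K. (d k \<bullet> b)\<^sup>2)"
    and lip: "\<And>y z. norm (G y - G z) \<le> L * norm (y - z)"
    and descent: "\<And>y h. F (y + h) \<le> F y + h \<bullet> G y + L * (norm h)\<^sup>2"
    and below: "\<And>y. m \<le> F y"
    and \<alpha>: "0 < \<alpha>" "0 \<le> L" "24 * (\<alpha> * L) \<le> s" and s: "0 < s" "s \<le> 1"
    and J: "linear J" "\<And>b. b \<in> A \<Longrightarrow> J b = b" "\<And>b. b \<in> B - A \<Longrightarrow> J b = 0"
  shows "(\<lambda>k. norm (x k - J (x k))) \<longlonglongrightarrow> 0" and "(\<lambda>k. norm (J (G (x k)))) \<longlonglongrightarrow> 0"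
proof -
  define l where "l = \<alpha> * L"
  have l: "0 \<le> l" "l \<le> s / 24" "l \<le> 1 / 24" using \<alpha> s by (auto simp: l_def)
  \<comment> \<open>Its values on the basis identify \<open>J\<close> as the orthogonal projection
    onto the span of \<open>A\<close>; the energies below split accordingly.\<close>
  have J_sum: "J y = (\<Sum>b\<in>A. (y \<bullet> b) *\<^sub>R b)" for y
  proof -
    have "J y = J (\<Sum>b\<in>B. (y \<bullet> b) *\<^sub>R b)"
      by (simp only: orthonormal_basis_expansion[OF B(2-4)])
    also have "\<dots> = (\<Sum>b\<in>B. (y \<bullet> b) *\<^sub>R J b)"
      using J(1) by (simp add: linear_sum linear_cmul)
    also have "\<dots> = (\<Sum>b\<in>A. (y \<bullet> b) *\<^sub>R J b)"
      using A B(1) J(3) by (intro sum.mono_neutral_right) auto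
    also have "\<dots> = (\<Sum>b\<in>A. (y \<bullet> b) *\<^sub>R b)" using J(2) by (intro sum.cong) auto
    finally show ?thesis .
  qed
  have bb: "b \<bullet> c = (if b = c then 1 else 0)" if "b \<in> B" "c \<in> B" for b c
    using that B(2,3) by (auto simp: dot_square_norm pairwise_def orthogonal_def)
  have J_inner: "J y \<bullet> b = (if b \<in> A then y \<bullet> b else 0)" if "b \<in> B" for y b
  proof -
    have "J y \<bullet> b = (\<Sum>c\<in>A. if c = b then y \<bullet> b else 0)"
      unfolding J_sum inner_sum_left using A that by (intro sum.cong refl) (auto simp: bb)
    then show ?thesis using A B(1) by (simp add: finite_subset sum.delta)
  qed
  have split: "(\<Sum>b\<in>B. h b) = (\<Sum>b\<in>A. h b) + (\<Sum>b\<in>B - A. h b)" for h :: "'a \<Rightarrow> real"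
    using A B(1) by (subst add.commute) (rule sum.subset_diff)
  have norm_J: "(norm (J y))\<^sup>2 = (\<Sum>b\<in>A. (y \<bullet> b)\<^sup>2)" for y
    using A by (simp add: orthonormal_basis_norm_sum[OF B(2-4)] split J_inner subset_iff)
  have norm_D: "(norm (y - J y))\<^sup>2 = (\<Sum>b\<in>B - A. (y \<bullet> b)\<^sup>2)" for y
    using A by (simp add: orthonormal_basis_norm_sum[OF B(2-4)] split J_inner inner_diff_left subset_iff)
  have norm_split: "(norm y)\<^sup>2 = (norm (J y))\<^sup>2 + (norm (y - J y))\<^sup>2" for y
    by (simp add: orthonormal_basis_norm_sum[OF B(2-4), of y] norm_J norm_D split)
  \<comment> \<open>\<open>U\<close> is the energy of the gradient step of the average,
    \<open>Q\<close> the disagreement, \<open>R\<close> the increment of the disagreement part, and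
    \<open>D\<close> the forcing.\<close>
  define U where "U k = (\<alpha> * norm (J (G (x k))))\<^sup>2" for k
  define Q where "Q k = (norm (x k - J (x k)))\<^sup>2" for k
  define R where "R k = (\<Sum>b\<in>B - A. (x (Suc k) \<bullet> b - x k \<bullet> b)\<^sup>2)" for k
  define D where "D k = (norm (d k))\<^sup>2" for k
  have pos: "0 \<le> U k" "0 \<le> Q k" "0 \<le> R k" "0 \<le> D k" for k
    by (auto simp: U_def Q_def R_def D_def intro: sum_nonneg)
  have d_modes: "(\<Sum>b\<in>B - A. \<Sum>k<K. (d k \<bullet> b)\<^sup>2) \<le> (\<Sum>k<K. D k)" for K
  proof -
    have "(\<Sum>b\<in>B - A. (d k \<bullet> b)\<^sup>2) \<le> D k" for k
      unfolding D_def norm_split[of "d k"] by (simp add: norm_D)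
    then show ?thesis by (subst sum.swap) (rule sum_mono)
  qed
  obtain C1 where C1: "0 \<le> C1" "\<And>K. (\<Sum>k<K. Q k) \<le> C1 + 1 / s ^ 4 * (\<Sum>k<K. D k)"
  proof -
    have "\<exists>C\<ge>0. \<forall>K. (\<Sum>b\<in>B - A. \<Sum>k<K. (x k \<bullet> b)\<^sup>2)
        \<le> C + 1 / s ^ 4 * (\<Sum>b\<in>B - A. \<Sum>k<K. (d k \<bullet> b)\<^sup>2)"
      by (rule uniform_bound_sum[OF _ gain]) (use B(1) in simp)
    then obtain C where C: "0 \<le> C" "\<And>K. (\<Sum>b\<in>B - A. \<Sum>k<K. (x k \<bullet> b)\<^sup>2)
        \<le> C + 1 / s ^ 4 * (\<Sum>b\<in>B - A. \<Sum>k<K. (d k \<bullet> b)\<^sup>2)"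
      by blast
    have "(\<Sum>k<K. Q k) \<le> C + 1 / s ^ 4 * (\<Sum>k<K. D k)" for K
    proof -
      have "(\<Sum>k<K. Q k) = (\<Sum>b\<in>B - A. \<Sum>k<K. (x k \<bullet> b)\<^sup>2)"
        unfolding Q_def norm_D by (rule sum.swap)
      also note C(2)
      also have "1 / s ^ 4 * (\<Sum>b\<in>B - A. \<Sum>k<K. (d k \<bullet> b)\<^sup>2) \<le> 1 / s ^ 4 * (\<Sum>k<K. D k)"
        using d_modes s by (intro mult_left_mono) auto
      finally show ?thesis by simp
    qed
    with C(1) show ?thesis by (rule that)
  qed
  obtain C2 where C2: "0 \<le> C2" "\<And>K. (\<Sum>k<K. R k) \<le> C2 + 192 / s\<^sup>2 * (\<Sum>k<K. D k)"
  proof -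
    have "\<exists>C\<ge>0. \<forall>K. (\<Sum>b\<in>B - A. \<Sum>k<K. (x (Suc k) \<bullet> b - x k \<bullet> b)\<^sup>2)
        \<le> C + 192 / s\<^sup>2 * (\<Sum>b\<in>B - A. \<Sum>k<K. (d k \<bullet> b)\<^sup>2)"
      by (rule uniform_bound_sum[OF _ gain_diff]) (use B(1) in simp)
    then obtain C where C: "0 \<le> C" "\<And>K. (\<Sum>b\<in>B - A. \<Sum>k<K. (x (Suc k) \<bullet> b - x k \<bullet> b)\<^sup>2)
        \<le> C + 192 / s\<^sup>2 * (\<Sum>b\<in>B - A. \<Sum>k<K. (d k \<bullet> b)\<^sup>2)"
      by blast
    have "(\<Sum>k<K. R k) \<le> C + 192 / s\<^sup>2 * (\<Sum>k<K. D k)" for K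
    proof -
      have "(\<Sum>k<K. R k) = (\<Sum>b\<in>B - A. \<Sum>k<K. (x (Suc k) \<bullet> b - x k \<bullet> b)\<^sup>2)"
        unfolding R_def by (rule sum.swap)
      also note C(2)
      also have "192 / s\<^sup>2 * (\<Sum>b\<in>B - A. \<Sum>k<K. (d k \<bullet> b)\<^sup>2) \<le> 192 / s\<^sup>2 * (\<Sum>k<K. D k)"
        using d_modes s by (intro mult_left_mono) auto
      finally show ?thesis by simp
    qed
    with C(1) show ?thesis by (rule that)
  qed
  have J_step: "J (x (Suc k)) = J (x k) - \<alpha> *\<^sub>R J (G (x k))" for k
    unfolding J_sum scaleR_sum_right sum_subtractf[symmetric]
    by (intro sum.cong refl) (simp add: mean algebra_simps)
  \<comment> \<open>The consensus part of an increment of \<open>x\<close> has energy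
    \<open>U\<close>, the disagreement part \<open>R\<close>; they add by orthogonality.\<close>
  have D_le: "D k \<le> l\<^sup>2 * (U k + R k)" for k
  proof -
    have "norm (d k) \<le> l * norm (x (Suc k) - x k)"
      unfolding d_def l_def using lip[of "x (Suc k)" "x k"] \<alpha> by simp
    then have "D k \<le> (l * norm (x (Suc k) - x k))\<^sup>2"
      unfolding D_def by (intro power_mono) auto
    moreover have "J (x (Suc k) - x k) = - (\<alpha> *\<^sub>R J (G (x k)))"
      by (simp add: linear_diff[OF J(1)] J_step)
    then have "(norm (x (Suc k) - x k))\<^sup>2 = U k + R k"
      unfolding norm_split[of "x (Suc k) - x k"] norm_D U_def R_def
      using \<alpha> by (simp add: inner_diff_left)
    ultimately show ?thesis by (simp add: power_mult_distrib)
  qed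
  \<comment> \<open>Descent at the average with step \<open>h\<close>. Young's inequality handles
    the error of taking the gradient at \<open>x k\<close> and not at \<open>J (x k)\<close>;
    multiplying by \<alpha> expresses everything through \<open>U\<close>, \<open>Q\<close> and
    \<open>l\<close>.\<close>
  have F_step: "\<alpha> * F (J (x (Suc k))) + (1 / 2 - l) * U k \<le> \<alpha> * F (J (x k)) + l\<^sup>2 / 2 * Q k" for k
  proof -
    define g where "g = J (G (x k))"
    define h where "h = - (\<alpha> *\<^sub>R g)"
    have "h \<bullet> G (x k) = - \<alpha> * (norm g)\<^sup>2"
      unfolding h_def g_def norm_J
      by (simp add: J_sum inner_sum_left inner_commute[of "G (x k)"] power2_eq_square)
    moreover have "h \<bullet> (G (J (x k)) - G (x k)) \<le> \<alpha> * norm g * (L * norm (x k - J (x k)))"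
    proof -
      have "h \<bullet> (G (J (x k)) - G (x k)) \<le> norm h * norm (G (J (x k)) - G (x k))"
        by (rule norm_cauchy_schwarz)
      also have "\<dots> \<le> norm h * (L * norm (x k - J (x k)))"
        using lip[of "J (x k)" "x k"] by (intro mult_left_mono) (auto simp: norm_minus_commute)
      finally show ?thesis using \<alpha> by (simp add: h_def)
    qed
    moreover have "F (J (x (Suc k))) \<le> F (J (x k)) + h \<bullet> G (J (x k)) + L * (norm h)\<^sup>2"
      using descent[of "J (x k)" h] by (simp add: J_step h_def g_def)
    moreover have "(norm h)\<^sup>2 = U k" using \<alpha> by (simp add: h_def U_def g_def)
    ultimately have "F (J (x (Suc k))) \<le> F (J (x k)) - \<alpha> * (norm g)\<^sup>2
        + \<alpha> * norm g * (L * norm (x k - J (x k))) + L * U k"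
      by (simp add: inner_diff_right)
    then have "\<alpha> * F (J (x (Suc k))) \<le> \<alpha> * (F (J (x k)) - \<alpha> * (norm g)\<^sup>2
        + \<alpha> * norm g * (L * norm (x k - J (x k))) + L * U k)"
      using \<alpha> by (intro mult_left_mono) auto
    also have "\<dots> = \<alpha> * F (J (x k)) - U k + (\<alpha> * norm g) * (l * norm (x k - J (x k))) + l * U k"
      by (simp add: U_def l_def g_def algebra_simps power2_eq_square)
    also have "(\<alpha> * norm g) * (l * norm (x k - J (x k))) \<le> U k / 2 + l\<^sup>2 / 2 * Q k"
      using sum_squares_bound[of "\<alpha> * norm g" "l * norm (x k - J (x k))"]
      by (simp add: U_def Q_def g_def power_mult_distrib)
    finally show ?thesis by (simp add: algebra_simps)
  qed
  define C0 where "C0 = \<alpha> * (F (J (x 0)) - m)"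
  have descent_sum: "(1 / 2 - l) * (\<Sum>k<K. U k) \<le> C0 + l\<^sup>2 / 2 * (\<Sum>k<K. Q k)" for K
  proof -
    have "(\<Sum>k<K. (1 / 2 - l) * U k) \<le> \<alpha> * (F (J (x 0)) - m) + (\<Sum>k<K. l\<^sup>2 / 2 * Q k)"
      using F_step below \<alpha> by (intro dissipation_sum_le) (auto simp: algebra_simps)
    then show ?thesis unfolding sum_distrib_left C0_def .
  qed
  define c where "c = C0 + C1 + C2"
  \<comment> \<open>All from \<open>l \<le> s / 24\<close>: 192 / 24^2 is 1/3, and 24^4 is far above
    100. The bound on \<open>Q\<close> enters with one \<open>l\<^sup>2\<close> from the descent and
    one from \<open>D_le\<close>, which together pay for \<open>s ^ 4\<close>.\<close>
  have l_s: "l\<^sup>2 * (192 / s\<^sup>2) \<le> 1 / 3" "l\<^sup>2 * (l\<^sup>2 * (1 / s ^ 4)) \<le> 1 / 100" "l\<^sup>2 \<le> 1"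
  proof -
    have *: "l\<^sup>2 \<le> s\<^sup>2 / 576" using power_mono[OF l(2,1), of 2] by (simp add: power_divide)
    then show "l\<^sup>2 * (192 / s\<^sup>2) \<le> 1 / 3" using s by (simp add: field_simps)
    have "l\<^sup>2 * l\<^sup>2 \<le> s\<^sup>2 / 576 * (s\<^sup>2 / 576)" using * by (intro mult_mono) auto
    also have "\<dots> \<le> s ^ 4 / 100" using s by (simp add: power4_eq_xxxx power2_eq_square)
    finally show "l\<^sup>2 * (l\<^sup>2 * (1 / s ^ 4)) \<le> 1 / 100" using s by (simp add: field_simps)
    show "l\<^sup>2 \<le> 1" using l by (simp add: power_le_one)
  qed
  \<comment> \<open>The loop is closed by eliminating first \<open>R\<close>, then \<open>D\<close>
    and \<open>Q\<close>, until an inequality for the sum of \<open>U\<close> alone remains.\<close>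
  have bounds: "(\<Sum>k<K. U k) \<le> 10 * c \<and> (\<Sum>k<K. Q k) \<le> c + 1 / s ^ 4 * (20 * c)" for K
  proof -
    let ?U = "\<Sum>k<K. U k" and ?Q = "\<Sum>k<K. Q k" and ?R = "\<Sum>k<K. R k" and ?D = "\<Sum>k<K. D k"
    have p: "0 \<le> ?U" "0 \<le> ?Q" "0 \<le> ?R" "0 \<le> ?D" using pos by (auto intro: sum_nonneg)
    have C0: "0 \<le> C0" unfolding C0_def using below \<alpha> by simp
    have D1: "?D \<le> l\<^sup>2 * (?U + ?R)"
      unfolding sum.distrib[symmetric] sum_distrib_left by (intro sum_mono D_le)
    have "192 / s\<^sup>2 * ?D \<le> 192 / s\<^sup>2 * (l\<^sup>2 * (?U + ?R))"
      using D1 by (intro mult_left_mono) auto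
    also have "\<dots> = l\<^sup>2 * (192 / s\<^sup>2) * (?U + ?R)" by simp
    also have "\<dots> \<le> 1 / 3 * (?U + ?R)" using l_s p by (intro mult_right_mono) auto
    finally have "?R \<le> C2 + 1 / 3 * (?U + ?R)"
      by (intro order_trans[OF C2(2)] add_left_mono)
    then have R1: "?R \<le> 3 / 2 * C2 + ?U / 2" by argo
    have "l\<^sup>2 * (?U + ?R) \<le> l\<^sup>2 * (3 / 2 * (C2 + ?U))"
      using R1 by (intro mult_left_mono) auto
    with D1 have D2: "?D \<le> l\<^sup>2 * (3 / 2 * (C2 + ?U))" by linarith
    have "l\<^sup>2 * ?Q \<le> l\<^sup>2 * (C1 + 1 / s ^ 4 * (l\<^sup>2 * (3 / 2 * (C2 + ?U))))"
      using D2 s by (intro mult_left_mono order_trans[OF C1(2)] add_left_mono) auto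
    also have "\<dots> = l\<^sup>2 * C1 + l\<^sup>2 * (l\<^sup>2 * (1 / s ^ 4)) * (3 / 2 * (C2 + ?U))"
      by (simp add: algebra_simps)
    also have "\<dots> \<le> 1 * C1 + 1 / 100 * (3 / 2 * (C2 + ?U))"
      using l_s C1(1) C2(1) p by (intro add_mono mult_right_mono) auto
    finally have Q1: "l\<^sup>2 * ?Q \<le> C1 + 1 / 100 * (3 / 2 * (C2 + ?U))" by simp
    \<comment> \<open>Here 11/24 is 1/2 - 1/24. The loop through \<open>Q\<close> returns only 3/400
      of \<open>?U\<close>, so a positive multiple of \<open>?U\<close> stays on the left.\<close>
    have "11 / 24 * ?U \<le> (1 / 2 - l) * ?U" using l p by (intro mult_right_mono) auto
    also note descent_sum[of K]
    also have "C0 + l\<^sup>2 / 2 * ?Q = C0 + l\<^sup>2 * ?Q / 2" by simp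
    also have "\<dots> \<le> C0 + (C1 + 1 / 100 * (3 / 2 * (C2 + ?U))) / 2"
      using Q1 by simp
    finally have U1: "?U \<le> 10 * c" unfolding c_def using C0 C1(1) C2(1) p by argo
    have "l\<^sup>2 * (3 / 2 * (C2 + ?U)) \<le> 1 * (3 / 2 * (C2 + ?U))"
      using l_s C2(1) p by (intro mult_right_mono) auto
    with D2 have "?D \<le> 3 / 2 * (C2 + ?U)" by (simp only: mult_1)
    with U1 have "?D \<le> 20 * c" unfolding c_def using C0 C1(1) C2(1) by argo
    then have "1 / s ^ 4 * ?D \<le> 1 / s ^ 4 * (20 * c)" using s by (intro mult_left_mono) auto
    with C1(2)[of K] have "?Q \<le> C1 + 1 / s ^ 4 * (20 * c)" by (rule order_trans[OF _ add_left_mono])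
    moreover have "C1 \<le> c" unfolding c_def using C0 C2(1) by simp
    ultimately show ?thesis using U1 by (meson add_right_mono order_trans)
  qed
  have "Q \<longlonglongrightarrow> 0" using bounds pos by (intro bounded_sums_tendsto_0) auto
  from tendsto_real_sqrt[OF this] show "(\<lambda>k. norm (x k - J (x k))) \<longlonglongrightarrow> 0"
    by (simp add: Q_def)
  have "U \<longlonglongrightarrow> 0" using bounds pos by (intro bounded_sums_tendsto_0) auto
  from tendsto_mult_left[OF tendsto_real_sqrt[OF this], of "1 / \<alpha>"]
  show "(\<lambda>k. norm (J (G (x k)))) \<longlonglongrightarrow> 0"
    using \<alpha> by (simp add: U_def)
qed

text \<open>Self-adjointness turns \<open>W\<close> and \<open>V\<close> into the scalars
  \<open>w\<close> and \<open>v\<close>. If \<open>w = 1\<close> then \<open>v = 1\<close>, and the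
  recursion says that the component along \<open>b\<close> of
  \<open>x (Suc k) - x k + \<alpha> *\<^sub>R G (x k)\<close> does not depend on \<open>k\<close>;
  the special first step of EXTRA makes it zero.\<close>

lemma extra_inner_eigenvector:
  fixes W V :: "real ^ 'm ^ 'm::finite" and b x0 :: "real ^ ('m \<times> 'n::finite)"
    and f :: "'m \<Rightarrow> real ^ 'n \<Rightarrow> real" and \<alpha> :: real
  defines "x \<equiv> extra W V f \<alpha> x0" and "G \<equiv> gradient (stacked_sum f)"
  assumes W_sym: "transpose W = W" and b: "(W \<otimes>\<^sub>K mat 1) *v b = w *\<^sub>R b"
    and V: "V = \<theta> *\<^sub>R mat 1 + (1 - \<theta>) *\<^sub>R W" and v: "v = \<theta> + (1 - \<theta>) * w"
  shows "x (Suc (Suc k)) \<bullet> b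
      = (1 + w) * (x (Suc k) \<bullet> b) - v * (x k \<bullet> b) - (\<alpha> *\<^sub>R (G (x (Suc k)) - G (x k))) \<bullet> b"
    and "w = 1 \<Longrightarrow> x (Suc k) \<bullet> b = x k \<bullet> b - \<alpha> * (G (x k) \<bullet> b)"
proof -
  have W_inner: "((W \<otimes>\<^sub>K mat 1) *v y) \<bullet> b = w * (y \<bullet> b)" for y
    by (simp add: symmetric_kronecker_mat_1_self_adjoint[OF W_sym] b)
  have "(V \<otimes>\<^sub>K mat 1) *v y = \<theta> *\<^sub>R y + (1 - \<theta>) *\<^sub>R ((W \<otimes>\<^sub>K mat 1) *v y)" for y :: "real ^ ('m \<times> 'n)"
    by (rule coord_slice_eqI)
      (simp add: coord_slice_kronecker V matrix_vector_mult_add_rdistrib scaleR_matrix_vector_assoc[symmetric])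
  then have V_inner: "((V \<otimes>\<^sub>K mat 1) *v y) \<bullet> b = v * (y \<bullet> b)" for y
    by (simp only: inner_add_left inner_scaleR_left W_inner) (simp add: v algebra_simps)
  have x: "x 0 = x0" "x (Suc 0) = (W \<otimes>\<^sub>K mat 1) *v x0 - \<alpha> *\<^sub>R G x0"
    "x (Suc (Suc k)) = x (Suc k) + (W \<otimes>\<^sub>K mat 1) *v x (Suc k) - (V \<otimes>\<^sub>K mat 1) *v x k
      - \<alpha> *\<^sub>R (G (x (Suc k)) - G (x k))" for k
    by (simp_all add: x_def G_def)
  show rec: "x (Suc (Suc k)) \<bullet> b
      = (1 + w) * (x (Suc k) \<bullet> b) - v * (x k \<bullet> b) - (\<alpha> *\<^sub>R (G (x (Suc k)) - G (x k))) \<bullet> b" for k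
    unfolding x(3) inner_diff_left[of _ _ b] inner_add_left W_inner V_inner by (simp add: distrib_right)
  assume w: "w = 1"
  show "x (Suc k) \<bullet> b = x k \<bullet> b - \<alpha> * (G (x k) \<bullet> b)"
  proof (induction k)
    case 0
    show ?case unfolding x(1,2) by (simp add: inner_diff_left W_inner w)
  next
    case (Suc k)
    then show ?case unfolding rec by (simp add: w v inner_diff_left right_diff_distrib)
  qed
qed

text \<open>Eigenvectors of a symmetric matrix for distinct eigenvalues are orthogonal, so
  \<open>q\<close> is orthogonal to the all-ones vector.\<close>

lemma avg_matrix_mult_eigenvector:
  fixes W :: "real ^ 'm ^ 'm::finite"
  assumes W: "transpose W = W" "W *v vec 1 = vec 1" and q: "W *v q = w *\<^sub>R q" "w \<noteq> 1"
  shows "avg_matrix *v q = 0"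
proof -
  have "(W *v q) \<bullet> vec 1 = q \<bullet> (W *v vec 1)"
    by (metis W(1) dot_lmul_matrix transpose_matrix_vector)
  then have "q \<bullet> vec 1 = 0" using W(2) q by simp
  then show ?thesis by (simp add: avg_matrix_mult)
qed

theorem mainTheorem1:
  fixes f :: "'m::finite \<Rightarrow> real ^ 'n::finite \<Rightarrow> real"
    and E :: "('m \<times> 'm) set"
    and W V :: "real ^ 'm ^ 'm"
    and Lf :: "'m \<Rightarrow> real"
    and LF \<alpha> :: real
    and x0 :: "real ^ ('m \<times> 'n)"
  assumes diff: "\<And>i x. f i differentiable (at x)"
    and lipschitz: "\<And>i x y. norm (gradient (f i) x - gradient (f i) y) \<le> Lf i * norm (x - y)"
    and coercive: "\<And>i. coercive (f i)"
    and undirected: "sym E"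
    and connected: "connected_graph E"
    and W_sparse: "\<And>i j. i \<noteq> j \<Longrightarrow> (i, j) \<notin> E \<Longrightarrow> W $ i $ j = 0"
    and W_sym: "W = transpose W"
    and W_lower: "pos_def (W - (- mat 1))"
    and W_upper: "pos_semidef (mat 1 - W)"
    and W_null: "{v. (mat 1 - W) *v v = 0} = span {vec 1}"
    and V: "\<exists>\<theta>. 0 < \<theta> \<and> \<theta> \<le> 1 / 2 \<and> V = \<theta> *\<^sub>R mat 1 + (1 - \<theta>) *\<^sub>R W"
    and V_pos: "pos_def V"
    and LF: "LF = Max (range Lf)"
    and \<alpha>_pos: "0 < \<alpha>"
    and \<alpha>_less: "\<alpha> < (1 - (spectral_radius (P_matrix W V))\<^sup>2) / (6 * LF ^ 4 + 6 * LF ^ 3 + 48 * LF + 1)"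
  shows "(\<lambda>k. norm ((mat 1 - avg_matrix \<otimes>\<^sub>K (mat 1 :: real ^ 'n ^ 'n)) *v extra W V f \<alpha> x0 k))
           \<longlonglongrightarrow> 0
       \<and> (\<lambda>k. norm ((avg_matrix \<otimes>\<^sub>K (mat 1 :: real ^ 'n ^ 'n))
                *v gradient (stacked_sum f) (extra W V f \<alpha> x0 k))) \<longlonglongrightarrow> 0"
proof -
  define x where "x = extra W V f \<alpha> x0"
  define G where "G = gradient (stacked_sum f)"
  define d where "d k = \<alpha> *\<^sub>R (G (x (Suc k)) - G (x k))" for k
  define Wh where "Wh y = (W \<otimes>\<^sub>K mat 1) *v y" for y :: "real ^ ('m \<times> 'n)"
  define J where "J y = (avg_matrix \<otimes>\<^sub>K mat 1) *v y" for y :: "real ^ ('m \<times> 'n)"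
  \<comment> \<open>The absolute value spares a proof that \<open>Max\<close> is not taken over the empty set.\<close>
  define \<rho> where "\<rho> = \<bar>spectral_radius (P_matrix W V)\<bar>"
  define s where "s = 1 - \<rho>"
  obtain \<theta> where \<theta>: "0 < \<theta>" "\<theta> \<le> 1 / 2" and V\<theta>: "V = \<theta> *\<^sub>R mat 1 + (1 - \<theta>) *\<^sub>R W"
    using V by blast
  note W_transpose = W_sym[symmetric]
  have W1: "W *v vec 1 = vec 1"
  proof -
    have "(mat 1 - W) *v vec 1 = 0" using W_null span_base[of "vec 1" "{vec 1}"] by blast
    then show ?thesis by (simp add: matrix_vector_mult_diff_rdistrib)
  qed

  \<comment> \<open>Regularity and lower bound of the stacked objective\<close>
  have Lf_le: "Lf i \<le> LF" for i unfolding LF by simp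
  have lip_LF: "norm (gradient (f i) y - gradient (f i) z) \<le> LF * norm (y - z)" for i y z
    using lipschitz[of i y z] mult_right_mono[OF Lf_le norm_ge_zero] by (rule order_trans)
  \<comment> \<open>The Lipschitz bound between two distinct points, \<open>vec 1\<close> and
    \<open>0\<close>, forces a nonnegative constant.\<close>
  have LF0: "0 \<le> LF"
  proof -
    have "0 \<le> LF * norm (vec 1 - 0 :: real ^ 'n)"
      by (rule order_trans[OF norm_ge_zero lip_LF])
    moreover have "0 < norm (vec 1 - 0 :: real ^ 'n)" by (simp add: vec_eq_iff)
    ultimately show ?thesis by (simp add: zero_le_mult_iff)
  qed
  have F_diff: "stacked_sum f differentiable (at y)" for y
    using GDERIV_stacked_sum[of f, OF diff] unfolding gderiv_def differentiable_def by blast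
  have lip: "norm (G y - G z) \<le> LF * norm (y - z)" for y z
    unfolding G_def using diff LF0 lip_LF by (rule stacked_sum_gradient_lipschitz)
  have descent: "stacked_sum f (y + h) \<le> stacked_sum f y + h \<bullet> G y + LF * (norm h)\<^sup>2" for y h
    unfolding G_def using F_diff LF0 lip[unfolded G_def] by (rule lipschitz_gradient_descent)
  have "continuous_on UNIV (f i)" for i
    using diff by (simp add: continuous_at_imp_continuous_on differentiable_imp_continuous_within)
  then obtain m where below: "\<And>y. m \<le> stacked_sum f y"
    using stacked_sum_bounded_below coercive_bounded_below[OF _ coercive] by metis

  \<comment> \<open>Consequences of the step-size bound\<close>
  have den: "0 < 6 * LF ^ 4 + 6 * LF ^ 3 + 48 * LF + 1" using LF0 by (simp add: add_nonneg_pos)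
  have \<alpha>\<rho>: "\<alpha> * (6 * LF ^ 4 + 6 * LF ^ 3 + 48 * LF + 1) < 1 - \<rho>\<^sup>2"
    using \<alpha>_less den by (simp add: \<rho>_def pos_less_divide_eq)
  have \<rho>: "0 \<le> \<rho>" "\<rho> < 1"
  proof -
    \<comment> \<open>A positive step-size below the bound exists only if the numerator is positive;
      this is the source of \<open>\<rho> < 1\<close>.\<close>
    have "0 < \<alpha> * (6 * LF ^ 4 + 6 * LF ^ 3 + 48 * LF + 1)" using \<alpha>_pos den by simp
    with \<alpha>\<rho> have "\<rho>\<^sup>2 < 1" by linarith
    then show "\<rho> < 1" by (simp add: \<rho>_def abs_square_less_1)
  qed (simp add: \<rho>_def)
  have s: "0 < s" "s \<le> 1" using \<rho> by (auto simp: s_def)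
  have small: "24 * (\<alpha> * LF) \<le> s"
  proof -
    have "\<alpha> * (48 * LF) \<le> \<alpha> * (6 * LF ^ 4 + 6 * LF ^ 3 + 48 * LF + 1)"
      using \<alpha>_pos LF0 by (intro mult_left_mono) auto
    moreover have "1 - \<rho>\<^sup>2 \<le> 2 * s"
      using zero_le_power2[of "1 - \<rho>"] by (simp add: s_def power2_eq_square algebra_simps)
    ultimately show ?thesis using \<alpha>\<rho> by simp
  qed

  \<comment> \<open>Eigenbasis: consensus and disagreement modes\<close>
  have lin: "linear Wh" "linear J" unfolding Wh_def J_def by simp_all
  obtain B where B: "finite B" "pairwise orthogonal B" "\<And>b. b \<in> B \<Longrightarrow> norm b = 1" "span B = UNIV"
    and eig: "\<And>b. b \<in> B \<Longrightarrow> \<exists>w. Wh b = w *\<^sub>R b"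
    using self_adjoint_orthonormal_eigenbasis[OF lin(1)]
      symmetric_kronecker_mat_1_self_adjoint[OF W_transpose] unfolding Wh_def by metis
  define A where "A = {b \<in> B. Wh b = b}"

  \<comment> \<open>Every slice of \<open>b\<close> lies in the null space of
    \<open>mat 1 - W\<close>, so it is constant over the agents and averaging fixes it.\<close>
  have J_fix: "J b = b" if "b \<in> A" for b
    unfolding J_def
  proof (rule coord_slice_eqI)
    fix j
    have "W *v coord_slice b j = coord_slice b j"
      using that coord_slice_kronecker[of W b j] by (simp add: A_def Wh_def)
    then have "(mat 1 - W) *v coord_slice b j = 0" by (simp add: matrix_vector_mult_diff_rdistrib)
    then have "coord_slice b j \<in> span {vec 1}" using W_null by blast
    then show "coord_slice ((avg_matrix \<otimes>\<^sub>K mat 1) *v b) j = coord_slice b j"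
      by (simp add: coord_slice_kronecker avg_matrix_mult_span)
  qed
  \<comment> \<open>The vector \<open>q\<close> is a nonzero slice of \<open>b\<close>, an
    eigenvector of \<open>W\<close> itself; it links the mode to the eigenvalues of
    \<open>P_matrix W V\<close>.\<close>
  have disagreement: "\<exists>w. Wh b = w *\<^sub>R b \<and> w \<noteq> 1 \<and> J b = 0 \<and>
      (\<exists>q. q \<noteq> 0 \<and> W *v q = w *\<^sub>R q \<and> avg_matrix *v q = 0)" if "b \<in> B - A" for b
  proof -
    obtain w where w: "Wh b = w *\<^sub>R b" using eig \<open>b \<in> B - A\<close> by blast
    have w1: "w \<noteq> 1" using w that by (auto simp: A_def)
    have slice: "W *v coord_slice b j = w *\<^sub>R coord_slice b j" for j
      using w coord_slice_kronecker[of W b j] by (simp add: Wh_def)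
    then have avg: "avg_matrix *v coord_slice b j = 0" for j
      using avg_matrix_mult_eigenvector[OF W_transpose W1] w1 by blast
    then have "J b = 0" unfolding J_def by (intro coord_slice_eqI) (simp add: coord_slice_kronecker)
    moreover have "b \<noteq> 0" using B(3) that by force
    then obtain j where "coord_slice b j \<noteq> 0" using coord_slice_eqI[of b 0] by auto
    ultimately show ?thesis using w w1 slice avg by blast
  qed
  have J_ann: "J b = 0" if "b \<in> B - A" for b using disagreement[OF that] by blast

  \<comment> \<open>Recursions and gains of the single modes\<close>
  have mean: "x (Suc k) \<bullet> b = x k \<bullet> b - \<alpha> * (G (x k) \<bullet> b)" if "b \<in> A" for b k
    using extra_inner_eigenvector(2)[OF W_transpose _ V\<theta> refl, of b 1] that
    by (simp add: A_def Wh_def x_def G_def)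

  have gains: "(\<exists>C. \<forall>K. (\<Sum>k<K. (x k \<bullet> b)\<^sup>2) \<le> C + 1 / s ^ 4 * (\<Sum>k<K. (d k \<bullet> b)\<^sup>2)) \<and>
      (\<exists>C. \<forall>K. (\<Sum>k<K. (x (Suc k) \<bullet> b - x k \<bullet> b)\<^sup>2) \<le> C + 192 / s\<^sup>2 * (\<Sum>k<K. (d k \<bullet> b)\<^sup>2))"
    if "b \<in> B - A" for b
  proof -
    obtain w q where w: "Wh b = w *\<^sub>R b" "w \<noteq> 1"
      and q: "q \<noteq> 0" "W *v q = w *\<^sub>R q" "avg_matrix *v q = 0"
      using disagreement[OF \<open>b \<in> B - A\<close>] by blast
    define v where "v = \<theta> + (1 - \<theta>) * w"
    have Vq: "V *v q = v *\<^sub>R q"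
      by (simp add: V\<theta> v_def matrix_vector_mult_add_rdistrib scaleR_matrix_vector_assoc[symmetric]
          q(2) scaleR_add_left)
    have v0: "0 < v"
    proof -
      have "0 < v * (q \<bullet> q)" using V_pos q(1) Vq by (auto simp: pos_def_def)
      then show ?thesis using inner_ge_zero[of q] by (auto simp: zero_less_mult_iff)
    qed
    obtain r1 r2 where r: "r1 + r2 = complex_of_real (1 + w)" "r1 * r2 = complex_of_real v"
      by (rule complex_sum_prod_exist)
    have le: "cmod r1 \<le> \<rho>" "cmod r2 \<le> \<rho>"
    proof -
      have "z\<^sup>2 - of_real (1 + w) * z + of_real v = 0" if "z = r1 \<or> z = r2" for z
        unfolding r[symmetric] using that by (auto simp: algebra_simps power2_eq_square)
      then have "z \<in> complex_eigenvalues (P_matrix W V)" if "z = r1 \<or> z = r2" for z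
        using root_in_complex_eigenvalues_P_matrix[OF q(2) Vq q(3,1)] that by blast
      then have "cmod z \<le> \<rho>" if "z = r1 \<or> z = r2" for z
        unfolding \<rho>_def using cmod_eigenvalue_le_spectral_radius that 
        by (intro order_trans[OF _ abs_ge_self]) blast
      then show "cmod r1 \<le> \<rho>" "cmod r2 \<le> \<rho>" by blast+
    qed
    \<comment> \<open>As the product of two roots of modulus at most \<open>\<rho> < 1\<close>,
      \<open>v\<close> satisfies \<open>1 - v \<ge> s\<close>, which makes the increment gain
      uniform over the modes.\<close>
    have v\<rho>: "v \<le> \<rho>"
    proof -
      have "v = cmod r1 * cmod r2" using v0 by (simp flip: norm_mult add: r(2))
      also have "\<dots> \<le> 1 * \<rho>" using le \<rho> by (intro mult_mono) auto
      finally show ?thesis by simp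
    qed
    have rec: "x (Suc (Suc k)) \<bullet> b = (1 + w) * (x (Suc k) \<bullet> b) - v * (x k \<bullet> b) - d k \<bullet> b" for k
      unfolding d_def x_def G_def v_def
      by (rule extra_inner_eigenvector(1)[OF W_transpose _ V\<theta> refl]) (use w(1) Wh_def in simp)
    have "\<exists>C. \<forall>K. (\<Sum>k<K. (x (Suc k) \<bullet> b - x k \<bullet> b)\<^sup>2) \<le> C + 192 / (1 - v)\<^sup>2 * (\<Sum>k<K. (d k \<bullet> b)\<^sup>2)"
      using second_order_recursion_increment_l2_gain[where c = "\<lambda>k. x k \<bullet> b" and d = "\<lambda>k. d k \<bullet> b", OF rec \<theta> v_def v0] v\<rho> \<rho> by simp
    then obtain C where C: "\<And>K. (\<Sum>k<K. (x (Suc k) \<bullet> b - x k \<bullet> b)\<^sup>2) \<le> C + 192 / (1 - v)\<^sup>2 * (\<Sum>k<K. (d k \<bullet> b)\<^sup>2)"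
      by blast
    have "192 / (1 - v)\<^sup>2 \<le> 192 / s\<^sup>2"
      using s v\<rho> by (intro divide_left_mono power_mono mult_pos_pos) (auto simp: s_def)
    then have "192 / (1 - v)\<^sup>2 * (\<Sum>k<K. (d k \<bullet> b)\<^sup>2) \<le> 192 / s\<^sup>2 * (\<Sum>k<K. (d k \<bullet> b)\<^sup>2)" for K
      by (intro mult_right_mono sum_nonneg) auto
    then have "(\<Sum>k<K. (x (Suc k) \<bullet> b - x k \<bullet> b)\<^sup>2) \<le> C + 192 / s\<^sup>2 * (\<Sum>k<K. (d k \<bullet> b)\<^sup>2)" for K
      by (intro order_trans[OF C] add_left_mono)
    moreover have "\<exists>C. \<forall>K. (\<Sum>k<K. (x k \<bullet> b)\<^sup>2) \<le> C + 1 / s ^ 4 * (\<Sum>k<K. (d k \<bullet> b)\<^sup>2)"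
      using second_order_recursion_l2_gain[where c = "\<lambda>k. x k \<bullet> b" and d = "\<lambda>k. d k \<bullet> b", OF rec r le \<rho>(2)] by (simp add: s_def)
    ultimately show ?thesis by blast
  qed

  have "A \<subseteq> B" by (auto simp: A_def)
  note converge = small_gain_consensus[where x = x and G = G and F = "stacked_sum f" and \<alpha> = \<alpha>,
      OF B this mean gains[THEN conjunct1, unfolded d_def] gains[THEN conjunct2, unfolded d_def]
        lip descent below \<alpha>_pos LF0 small s lin(2) J_fix J_ann]
  show ?thesis
    using converge unfolding x_def[symmetric] G_def[symmetric]
    by (simp add: matrix_vector_mult_diff_rdistrib flip: J_def)
qed

end
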